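(* There exist absolute constants $c, C>0$ such that the following holds. Let $k\ge 1$ be an integer. Let $I\subset\mathbb{R}$ be a finite set and let $f$ be $k$-convex on $I$. Let $\epsilon\ge 0$ be such that $|I+I-I|\le |I|^{1+\epsilon}$. Then for every integer $1\le l\le 2^k$ with $\epsilon\le \frac{\log l}{l}$, \[ \mathsf{T}^{+}_{2^l}(f(I))\le C\,|I|^{2^{l+1}-c\log l}. \]
   Context: $\log$ is base $2$. A function $f$ is $k$-convex on $I$ if it is defined and $k$ times differentiable on an interval containing $I$, and its first $k$ derivatives $f',\dots,f^{(k)}$ are each strictly monotone there. $I+I-I=\{i_1+i_2-i_3: i_j\in I\}$ and $f(I)=\{f(i):i\in I\}$. For a finite set $A$ and an integer $m\ge1$, \[ \mathsf{T}^{+}_m(A)=|\{(a_1,\dots,a_m,a'_1,\dots,a'_m)\in A^{2m}: a_1+\dots+a_m=a'_1+\dots+a'_m\}|. \] *)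

theory Defs
  imports "HOL-Analysis.Analysis"
begin

text \<open>
  The interval \<open>J\<close> is taken to be nondegenerate, so that the (one-sided at endpoints) derivatives
  within \<open>J\<close> are unique. The function \<open>g j\<close> is the \<open>j\<close>-th derivative of \<open>f\<close> on \<open>J\<close>.
\<close>

definition k_convex_on :: "nat \<Rightarrow> real set \<Rightarrow> (real \<Rightarrow> real) \<Rightarrow> bool" where
  "k_convex_on k I f \<longleftrightarrow>
     (\<exists>J g. is_interval J \<and> interior J \<noteq> {} \<and> I \<subseteq> J \<and>
        (\<forall>x\<in>J. g 0 x = f x) \<and>
        (\<forall>j<k. \<forall>x\<in>J. (g j has_real_derivative g (Suc j) x) (at x within J)) \<and>
        (\<forall>j\<in>{1..k}. strict_mono_on J (g j) \<or> strict_antimono_on J (g j)))"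

text \<open>Written out explicitly because \<open>-\<close> on sets is set difference.\<close>

definition sum_diff_set :: "real set \<Rightarrow> real set" where
  "sum_diff_set I = {i1 + i2 - i3 | i1 i2 i3. i1 \<in> I \<and> i2 \<in> I \<and> i3 \<in> I}"

definition additive_energy :: "nat \<Rightarrow> real set \<Rightarrow> nat" where
  "additive_energy m A =
     card {(xs, ys). length xs = m \<and> length ys = m \<and> set xs \<subseteq> A \<and> set ys \<subseteq> A \<and>
                     sum_list xs = sum_list ys}"

end

theory Submission
  imports Defs
begin

text \<open>
  Write \<open>N = |I|\<close>, \<open>E = I + I - I\<close>, \<open>|E| = K N\<close>, and let \<open>t\<^sub>m\<close> be the \<open>m\<close>-fold energy of \<open>f\<close> divided
  by \<open>N\<^bsup>2m\<^esup>\<close>. Solutions of \<open>f i + b = f i' + b'\<close>, with \<open>b\<close>, \<open>b'\<close> sums of \<open>m\<close> values of \<open>f\<close>, are localised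
  (an idea of Garaev): cut \<open>E\<close> into blocks of \<open>H\<close> elements and the sums, in increasing order, into
  blocks of equal size. For fixed \<open>x\<close> the curve \<open>f i + b = x\<close> is a monotone staircase, so it meets about
  \<open>K N / H\<close> cells, and by Cauchy-Schwarz it suffices to count solutions with both sides in one cell.
  There \<open>d = i' - i\<close> takes at most \<open>H\<close> positive values, and \<open>b - b'\<close> equals the difference
  \<open>f (i + d) - f i\<close>, which is again a convex function, of one order less. Iterated Cauchy-Schwarz
  bounds this count by the energy of the difference function, and the localisation of \<open>b\<close>, \<open>b'\<close>
  gains a factor of nearly \<open>N\<close>. Hence multiplying the number of summands by 8 saves \<open>N\<^bsup>1/2\<^esup>\<close> for each
  order of convexity, and \<open>t\<^sub>m \<le> N\<^bsup>-k/2\<^esup>\<close> for \<open>m = 8\<^bsup>k\<^esup>\<close> unless \<open>N\<close> is small in terms of \<open>K\<close> and \<open>k\<close>.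

  If \<open>N\<close> is small compared with \<open>2\<^bsup>l\<^esup>\<close>, convexity is irrelevant: when \<open>t\<^bsub>m+1\<^esub>\<close> is extremely close to
  \<open>t\<^sub>m\<close>, the distribution of \<open>m\<close>-fold sums is almost invariant under some translation \<open>d \<noteq> 0\<close>, hence under
  many of its multiples, and so \<open>t\<^sub>m\<close> is tiny.
\<close>

section \<open>Collision counts and energies\<close>

text \<open>The inner product of the counting functions of \<open>v\<close> on \<open>P\<close> and
  \<open>w\<close> on \<open>Q\<close>. Values of arbitrary type allow pairs of a value and a cell
  label, so that the same notion also describes localised counts.\<close>

definition coll :: "'a set \<Rightarrow> ('a \<Rightarrow> 'c) \<Rightarrow> 'b set \<Rightarrow> ('b \<Rightarrow> 'c) \<Rightarrow> nat" where
  "coll P v Q w = card {(p, q). p \<in> P \<and> q \<in> Q \<and> v p = w q}"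

abbreviation self_coll :: "'a set \<Rightarrow> ('a \<Rightarrow> 'c) \<Rightarrow> nat" where
  "self_coll P v \<equiv> coll P v P v"

lemma finite_coll_set:
  assumes "finite P" "finite Q"
  shows "finite {(p, q). p \<in> P \<and> q \<in> Q \<and> v p = w q}"
  by (rule finite_subset[of _ "P \<times> Q"]) (use assms in auto)

lemma coll_eq_sum:
  assumes "finite P" "finite Q" "finite X" "v ` P \<subseteq> X"
  shows "coll P v Q w = (\<Sum>x\<in>X. card {p\<in>P. v p = x} * card {q\<in>Q. w q = x})"
proof -
  have "{(p, q). p \<in> P \<and> q \<in> Q \<and> v p = w q} = (\<Union>x\<in>X. {p\<in>P. v p = x} \<times> {q\<in>Q. w q = x})"
    using assms(4) by auto
  then have "coll P v Q w = card (\<Union>x\<in>X. {p\<in>P. v p = x} \<times> {q\<in>Q. w q = x})"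
    by (simp add: coll_def)
  also have "\<dots> = (\<Sum>x\<in>X. card ({p\<in>P. v p = x} \<times> {q\<in>Q. w q = x}))"
    by (rule card_UN_disjoint) (use assms in auto)
  finally show ?thesis by (simp add: card_cartesian_product)
qed

lemma coll_Cauchy_Schwarz:
  assumes "finite P" "finite Q"
  shows "(coll P v Q w)\<^sup>2 \<le> self_coll P v * self_coll Q w"
proof -
  let ?X = "v ` P \<union> w ` Q"
  let ?a = "\<lambda>x. real (card {p\<in>P. v p = x})" and ?b = "\<lambda>x. real (card {q\<in>Q. w q = x})"
  have "(\<Sum>x\<in>?X. ?a x * ?b x)\<^sup>2 \<le> (\<Sum>x\<in>?X. (?a x)\<^sup>2) * (\<Sum>x\<in>?X. (?b x)\<^sup>2)"
    by (rule Cauchy_Schwarz_ineq_sum)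
  then have "real ((coll P v Q w)\<^sup>2) \<le> real (self_coll P v * self_coll Q w)"
    by (subst (1 2 3) coll_eq_sum[where X = ?X]) (use assms in \<open>auto simp: power2_eq_square\<close>)
  then show ?thesis by (simp only: of_nat_le_iff)
qed

lemma coll_image_le:
  assumes "finite P" "P' \<subseteq> h ` P"
  shows "self_coll P' v \<le> self_coll P (v \<circ> h)"
proof -
  have "{(p, q). p \<in> P' \<and> q \<in> P' \<and> v p = v q} \<subseteq>
     map_prod h h ` {(p, q). p \<in> P \<and> q \<in> P \<and> (v \<circ> h) p = (v \<circ> h) q}"
  proof clarify
    fix p q assume "p \<in> P'" "q \<in> P'" and eq: "v p = v q"
    then obtain p0 q0 where "p = h p0" "p0 \<in> P" "q = h q0" "q0 \<in> P" using assms(2) by blast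
    then show "(p, q) \<in> map_prod h h ` {(p, q). p \<in> P \<and> q \<in> P \<and> (v \<circ> h) p = (v \<circ> h) q}"
      using eq by (intro image_eqI[of _ _ "(p0, q0)"]) auto
  qed
  then show ?thesis unfolding coll_def
    by (rule surj_card_le[rotated]) (rule finite_coll_set[OF assms(1) assms(1)])
qed

text \<open>Translates of a counting function have equal l2 norms, so by Cauchy-Schwarz its
  autocorrelation is largest at shift 0.\<close>

lemma coll_translate_le:
  fixes v :: "'a \<Rightarrow> real"
  assumes "finite P"
  shows "coll P (\<lambda>p. v p + a) P (\<lambda>p. v p + b) \<le> self_coll P v"
proof -
  have "self_coll P (\<lambda>p. v p + c) = self_coll P v" for c by (simp add: coll_def)
  with coll_Cauchy_Schwarz[OF assms assms, of "\<lambda>p. v p + a" "\<lambda>p. v p + b"]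
  have "(coll P (\<lambda>p. v p + a) P (\<lambda>p. v p + b))\<^sup>2 \<le> (self_coll P v)\<^sup>2" by (simp add: power2_eq_square)
  then show ?thesis by (rule power2_le_imp_le) simp
qed

lemma card_square_le_self_coll:
  assumes "finite P"
  shows "(card P)\<^sup>2 \<le> card (c ` P) * self_coll P c"
proof -
  have "card P = card (\<Union>y\<in>c ` P. {p\<in>P. c p = y})" by (rule arg_cong[where f = card]) auto
  also have "\<dots> = (\<Sum>y\<in>c ` P. card {p\<in>P. c p = y})"
    by (rule card_UN_disjoint) (use assms in auto)
  finally have 1: "real (card P) = (\<Sum>y\<in>c ` P. real (card {p\<in>P. c p = y}))" by simp
  have "(\<Sum>y\<in>c ` P. real (card {p\<in>P. c p = y}))\<^sup>2
     \<le> (\<Sum>y\<in>c ` P. (real (card {p\<in>P. c p = y}))\<^sup>2) * card (c ` P)"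
    using sum_squared_le_sum_of_squares[where I = "c ` P"] by simp
  then have "real ((card P)\<^sup>2) \<le> real (card (c ` P) * self_coll P c)"
    unfolding of_nat_power 1
    by (subst coll_eq_sum[where X = "c ` P"]) (use assms in \<open>auto simp: power2_eq_square mult.commute\<close>)
  then show ?thesis by (simp only: of_nat_le_iff)
qed

text \<open>Cauchy-Schwarz over the cells met by each fibre of \<open>v\<close>: a fibre spread over
  at most \<open>R\<close> cells has at least a proportion \<open>1 / R\<close> of its pairs within
  a common cell.\<close>

lemma self_coll_le_cells:
  assumes fin: "finite P" and R: "\<And>x. card (c ` {p\<in>P. v p = x}) \<le> R"
  shows "self_coll P v \<le> R * self_coll P (\<lambda>p. (v p, c p))"
proof -
  let ?P = "\<lambda>x. {p\<in>P. v p = x}"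
  have "self_coll P v = (\<Sum>x\<in>v ` P. (card (?P x))\<^sup>2)"
    by (subst coll_eq_sum[where X = "v ` P"]) (use fin in \<open>auto simp: power2_eq_square\<close>)
  also have "\<dots> \<le> (\<Sum>x\<in>v ` P. R * self_coll (?P x) c)"
    by (rule sum_mono, rule order_trans[OF card_square_le_self_coll[of _ c]]) (use fin R in auto)
  also have "\<dots> = R * (\<Sum>x\<in>v ` P. self_coll (?P x) c)" by (simp add: sum_distrib_left)
  also have "(\<Sum>x\<in>v ` P. self_coll (?P x) c)
     = card (\<Union>x\<in>v ` P. {(p, q). p \<in> ?P x \<and> q \<in> ?P x \<and> c p = c q})"
    unfolding coll_def
  proof (rule card_UN_disjoint[symmetric])
    show "\<forall>x\<in>v ` P. finite {(p, q). p \<in> ?P x \<and> q \<in> ?P x \<and> c p = c q}"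
      using fin by (intro ballI finite_coll_set) auto
  qed (use fin in auto)
  also have "(\<Union>x\<in>v ` P. {(p, q). p \<in> ?P x \<and> q \<in> ?P x \<and> c p = c q})
     = {(p, q). p \<in> P \<and> q \<in> P \<and> (v p, c p) = (v q, c q)}" by auto
  finally show ?thesis by (simp add: coll_def)
qed

section \<open>Energies of m-fold sums, indexed by tuples\<close>

definition tup :: "nat \<Rightarrow> 'a set \<Rightarrow> 'a list set" where
  "tup m S = {xs. set xs \<subseteq> S \<and> length xs = m}"

abbreviation sumf :: "('a \<Rightarrow> real) \<Rightarrow> 'a list \<Rightarrow> real" where
  "sumf f xs \<equiv> sum_list (map f xs)"

text \<open>Tuples of indices are counted, not tuples of values, so a non-injective
  \<open>f\<close>, such as a difference function, is treated with multiplicity.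
  \<open>energy_image_le\<close> returns to the energy of the image.\<close>

definition energy :: "nat \<Rightarrow> 'a set \<Rightarrow> ('a \<Rightarrow> real) \<Rightarrow> nat" where
  "energy m S f = self_coll (tup m S) (sumf f)"

lemma finite_tup [simp]: "finite S \<Longrightarrow> finite (tup m S)"
  unfolding tup_def by (rule finite_lists_length_eq)

lemma card_tup: "finite S \<Longrightarrow> card (tup m S) = card S ^ m"
  unfolding tup_def by (rule card_lists_length_eq)

lemma additive_energy_eq_energy: "additive_energy m A = energy m A (\<lambda>x. x)"
  unfolding additive_energy_def energy_def coll_def tup_def
  by (rule arg_cong[where f = card]) auto

lemma energy_image_le:
  assumes "finite S"
  shows "energy m (f ` S) (\<lambda>x. x) \<le> energy m S f"
proof -
  have "tup m (f ` S) \<subseteq> map f ` tup m S"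
  proof
    fix ys assume "ys \<in> tup m (f ` S)"
    then have "ys \<in> lists (f ` S)" "length ys = m" by (auto simp: tup_def)
    then obtain xs where "xs \<in> lists S" "ys = map f xs" by (auto simp: lists_image)
    then show "ys \<in> map f ` tup m S" using \<open>length ys = m\<close> by (auto simp: tup_def)
  qed
  from coll_image_le[OF finite_tup[OF assms] this, of "sumf (\<lambda>x. x)"]
  show ?thesis by (simp add: energy_def comp_def)
qed

lemma energy_Suc_le_self_coll:
  assumes "finite S"
  shows "energy (Suc m) S f \<le> self_coll (S \<times> tup m S) (\<lambda>(i, xs). f i + sumf f xs)"
proof -
  have "tup (Suc m) S \<subseteq> (\<lambda>(i, xs). i # xs) ` (S \<times> tup m S)"
    by (force simp: tup_def length_Suc_conv image_iff)
  from coll_image_le[OF _ this, of "sumf f"]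
  show ?thesis using assms by (simp add: energy_def comp_def case_prod_unfold)
qed

text \<open>Splitting off one summand on each side leaves autocorrelations of the m-fold sums at the
  shifts \<open>f j - f i\<close>. This serves both the trivial bound \<open>energy_Suc_le\<close>
  and the argument for few points.\<close>

lemma energy_Suc_le_sum:
  assumes "finite S"
  shows "energy (Suc m) S f \<le>
    (\<Sum>(i, j)\<in>S \<times> S. coll (tup m S) (\<lambda>p. sumf f p + f i) (tup m S) (\<lambda>p. sumf f p + f j))"
proof -
  let ?A = "\<lambda>i j. {(p, q). p \<in> tup m S \<and> q \<in> tup m S \<and> sumf f p + f i = sumf f q + f j}"
  have fin: "finite (?A i j)" for i j using assms by (intro finite_coll_set) auto
  have "{(p, q). p \<in> S \<times> tup m S \<and> q \<in> S \<times> tup m S \<and>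
      (case p of (i, xs) \<Rightarrow> f i + sumf f xs) = (case q of (i, xs) \<Rightarrow> f i + sumf f xs)}
    = (\<lambda>((i, j), p, q). ((i, p), (j, q))) ` (SIGMA (i, j) : S \<times> S. ?A i j)" (is "?L = ?h ` ?R")
    by (force simp: image_iff add.commute)
  then have "card ?L \<le> card ?R"
    by (simp only:) (rule card_image_le, use assms fin in auto)
  also have "card ?R = (\<Sum>(i, j)\<in>S \<times> S. card (?A i j))"
    by (subst card_SigmaI) (use assms fin in \<open>auto simp: case_prod_unfold\<close>)
  finally show ?thesis using energy_Suc_le_self_coll[OF assms, of m f] by (simp add: coll_def)
qed

lemma energy_Suc_le:
  assumes "finite S"
  shows "energy (Suc m) S f \<le> (card S)\<^sup>2 * energy m S f"
proof -
  have "energy (Suc m) S f \<le> (\<Sum>(i, j)\<in>S \<times> S. energy m S f)"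
    by (rule order_trans[OF energy_Suc_le_sum[OF assms]], rule sum_mono)
       (use assms in \<open>auto simp: energy_def intro!: coll_translate_le\<close>)
  then show ?thesis by (simp add: case_prod_unfold card_cartesian_product power2_eq_square)
qed

section \<open>Iterated Cauchy-Schwarz\<close>

text \<open>For a counting function \<open>\<beta>\<close> on blocks and the convolution operator \<open>T\<close> of \<open>g\<close> this is \<open>\<parallel>T\<^sup>m \<beta>\<parallel>\<^sup>2\<close>.
  The operator \<open>T\<close> is normal, which is what the lemma on doubling \<open>m\<close> exploits.\<close>

definition coll_tuples :: "'a set \<Rightarrow> ('a \<Rightarrow> real) \<Rightarrow> 'b set \<Rightarrow> ('b \<Rightarrow> 'c) \<Rightarrow> ('b \<Rightarrow> real) \<Rightarrow> nat \<Rightarrow> nat" where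
  "coll_tuples S g W blk v m = coll W (\<lambda>b. (blk b, v b)) (tup m S \<times> tup m S \<times> W)
     (\<lambda>(t, u, b). (blk b, v b + sumf g t - sumf g u))"

text \<open>Cauchy-Schwarz against the counting function of \<open>W\<close> leaves two copies of
  the system. Moving all terms to one side joins their tuples to \<open>t' @ u\<close> and
  \<open>u' @ t\<close>, which is the normality of \<open>T\<close>.\<close>

lemma coll_tuples_double:
  assumes "finite S" "finite W"
  shows "(coll_tuples S g W blk v m)\<^sup>2 \<le> self_coll W (\<lambda>b. (blk b, v b)) * coll_tuples S g W blk v (2 * m)"
proof -
  let ?Q = "tup m S \<times> tup m S \<times> W"
  let ?w = "\<lambda>(t, u, b). (blk b, v b + sumf g t - sumf g u)"
  let ?h = "\<lambda>((t, u, b), (t', u', b')). (b, (t' @ u, u' @ t, b'))"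
  have "self_coll ?Q ?w \<le> coll_tuples S g W blk v (2 * m)"
    unfolding coll_def coll_tuples_def
  proof (rule card_inj_on_le[where f = ?h])
    show "inj_on ?h {(p, q). p \<in> ?Q \<and> q \<in> ?Q \<and> ?w p = ?w q}"
      by (auto simp: inj_on_def tup_def)
    show "finite {(p, q). p \<in> W \<and> q \<in> tup (2 * m) S \<times> tup (2 * m) S \<times> W \<and> (blk p, v p) = ?w q}"
      using assms by (intro finite_coll_set) auto
  qed (auto simp: tup_def)
  then have "self_coll W (\<lambda>b. (blk b, v b)) * self_coll ?Q ?w
      \<le> self_coll W (\<lambda>b. (blk b, v b)) * coll_tuples S g W blk v (2 * m)" by simp
  with coll_Cauchy_Schwarz[of W ?Q "\<lambda>b. (blk b, v b)" ?w] assms show ?thesis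
    by (auto simp: coll_tuples_def intro: order_trans)
qed

lemma coll_tuples_power:
  assumes "finite S" "finite W"
  shows "coll_tuples S g W blk v 1 ^ (2 ^ j)
    \<le> self_coll W (\<lambda>b. (blk b, v b)) ^ (2 ^ j - 1) * coll_tuples S g W blk v (2 ^ j)"
proof (induction j)
  case (Suc j)
  let ?e = "self_coll W (\<lambda>b. (blk b, v b))"
  have "coll_tuples S g W blk v 1 ^ (2 ^ Suc j) = (coll_tuples S g W blk v 1 ^ (2 ^ j))\<^sup>2"
    by (simp add: power_mult[symmetric] mult.commute)
  also have "\<dots> \<le> (?e ^ (2 ^ j - 1) * coll_tuples S g W blk v (2 ^ j))\<^sup>2"
    using Suc by (rule power_mono) simp
  also have "\<dots> = ?e ^ (2 * (2 ^ j - 1)) * (coll_tuples S g W blk v (2 ^ j))\<^sup>2"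
    by (simp add: power_mult_distrib power_mult[symmetric] mult.commute)
  also have "\<dots> \<le> ?e ^ (2 * (2 ^ j - 1)) * (?e * coll_tuples S g W blk v (2 * 2 ^ j))"
    by (intro mult_left_mono coll_tuples_double assms) simp
  also have "\<dots> = ?e ^ Suc (2 * (2 ^ j - 1)) * coll_tuples S g W blk v (2 ^ Suc j)" by simp
  also have "Suc (2 * (2 ^ j - 1)) = 2 ^ Suc j - (1::nat)"
    using one_le_power[of "2::nat" j] unfolding power_Suc by arith
  finally show ?case .
qed simp

text \<open>A pair \<open>b\<close>, \<open>b'\<close> fixes the shift, so the admissible tuples
  form a translated collision count of \<open>g\<close>, at most its energy. Localisation enters
  through \<open>self_coll W blk\<close>, which counts only pairs in a common block.\<close>

lemma coll_tuples_le:
  assumes "finite S" "finite W"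
  shows "coll_tuples S g W blk v m \<le> energy m S g * self_coll W blk"
proof -
  let ?A = "\<lambda>b b'. {(t, u). t \<in> tup m S \<and> u \<in> tup m S \<and> sumf g t + v b' = sumf g u + v b}"
  let ?B = "{(b, b'). b \<in> W \<and> b' \<in> W \<and> blk b = blk b'}"
  have finB: "finite ?B" using assms by (intro finite_coll_set) auto
  have finA: "finite (?A b b')" for b b' using assms by (intro finite_coll_set) auto
  have "{(p, q). p \<in> W \<and> q \<in> tup m S \<times> tup m S \<times> W \<and>
      (blk p, v p) = (case q of (t, u, b) \<Rightarrow> (blk b, v b + sumf g t - sumf g u))}
     \<subseteq> (\<lambda>((b, b'), (t, u)). (b, (t, u, b'))) ` (SIGMA (b, b') : ?B. ?A b b')"
    by (force simp: image_iff)
  then have "coll_tuples S g W blk v m \<le> card (SIGMA (b, b') : ?B. ?A b b')"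
    unfolding coll_tuples_def coll_def by (rule surj_card_le[rotated]) (use finA finB in auto)
  also have "\<dots> = (\<Sum>(b, b')\<in>?B. card (?A b b'))"
    by (subst card_SigmaI) (use finA finB in \<open>auto simp: case_prod_unfold\<close>)
  also have "\<dots> \<le> (\<Sum>(b, b')\<in>?B. energy m S g)"
  proof (intro sum_mono, clarify)
    fix b b'
    show "card (?A b b') \<le> energy m S g"
      using coll_translate_le[of "tup m S" "sumf g" "v b'" "v b"] assms by (simp add: energy_def coll_def)
  qed
  also have "\<dots> = energy m S g * self_coll W blk" by (simp add: coll_def case_prod_unfold)
  finally show ?thesis .
qed

text \<open>A first Cauchy-Schwarz passes from \<open>i\<close> to pairs \<open>i\<close>,
  \<open>i'\<close>, and repeated doubling does the rest. After taking roots, the energy of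
  \<open>g\<close> and the number of same-block pairs enter with exponent
  \<open>1 / (2 * 2 ^ j)\<close>.\<close>

lemma coll_power_le:
  fixes v :: "'b \<Rightarrow> real"
  assumes "finite S" "finite W"
  shows "coll W (\<lambda>b. (blk b, v b)) (S \<times> W) (\<lambda>(i, b). (blk b, v b + g i)) ^ (2 * 2 ^ j)
    \<le> self_coll W v ^ (2 * 2 ^ j - 1) * (energy (2 ^ j) S g * self_coll W blk)"
proof -
  let ?e = "self_coll W (\<lambda>b. (blk b, v b))"
  let ?Q = "S \<times> W" and ?w = "\<lambda>(i, b). (blk b, v b + g i)"
  let ?F = "coll W (\<lambda>b. (blk b, v b)) ?Q ?w"
  let ?h = "\<lambda>((i, b), (i', b')). (b, ([i'], [i], b'))"
  have "self_coll ?Q ?w \<le> coll_tuples S g W blk v 1"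
    unfolding coll_def coll_tuples_def
  proof (rule card_inj_on_le[where f = ?h])
    show "inj_on ?h {(p, q). p \<in> ?Q \<and> q \<in> ?Q \<and> ?w p = ?w q}"
      by (auto simp: inj_on_def)
    show "finite {(p, q). p \<in> W \<and> q \<in> tup 1 S \<times> tup 1 S \<times> W \<and> (blk p, v p)
       = (case q of (t, u, b) \<Rightarrow> (blk b, v b + sumf g t - sumf g u))}"
      using assms by (intro finite_coll_set) auto
  qed (auto simp: tup_def)
  then have "?e * self_coll ?Q ?w \<le> ?e * coll_tuples S g W blk v 1" by (rule mult_le_mono2)
  with coll_Cauchy_Schwarz[of W ?Q "\<lambda>b. (blk b, v b)" ?w] assms
  have 1: "?F\<^sup>2 \<le> ?e * coll_tuples S g W blk v 1" by (auto intro: order_trans)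
  have "?F ^ (2 * 2 ^ j) = (?F\<^sup>2) ^ (2 ^ j)" by (simp add: power_mult)
  also have "\<dots> \<le> (?e * coll_tuples S g W blk v 1) ^ (2 ^ j)" using 1 by (rule power_mono) simp
  also have "\<dots> = ?e ^ (2 ^ j) * coll_tuples S g W blk v 1 ^ (2 ^ j)" by (simp add: power_mult_distrib)
  also have "\<dots> \<le> ?e ^ (2 ^ j) * (?e ^ (2 ^ j - 1) * coll_tuples S g W blk v (2 ^ j))"
    by (intro mult_left_mono coll_tuples_power assms) simp
  also have "\<dots> = ?e ^ (2 ^ j + (2 ^ j - 1)) * coll_tuples S g W blk v (2 ^ j)"
    by (simp only: power_add mult.assoc)
  also have "(2::nat) ^ j + (2 ^ j - 1) = 2 * 2 ^ j - 1"
    by simp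
  also have "?e ^ (2 * 2 ^ j - 1) * coll_tuples S g W blk v (2 ^ j)
      \<le> self_coll W v ^ (2 * 2 ^ j - 1) * (energy (2 ^ j) S g * self_coll W blk)"
  proof (intro mult_mono power_mono coll_tuples_le assms)
    show "?e \<le> self_coll W v" unfolding coll_def
      by (rule card_mono[OF finite_coll_set]) (use assms in auto)
  qed auto
  finally show ?thesis .
qed

section \<open>Blocks and staircases\<close>

text \<open>Ties in \<open>v\<close> are broken arbitrarily. Blocks of consecutive ranks therefore
  have a controlled size even if \<open>v\<close> takes some value very often.\<close>

lemma exists_rank:
  fixes v :: "'a \<Rightarrow> real"
  assumes "finite W"
  shows "\<exists>rk :: 'a \<Rightarrow> nat. bij_betw rk W {..<card W} \<and> (\<forall>b\<in>W. \<forall>b'\<in>W. v b < v b' \<longrightarrow> rk b < rk b')"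
proof -
  obtain xs0 where xs0: "set xs0 = W" "distinct xs0" using finite_distinct_list[OF assms] by blast
  define xs where "xs = sort_key v xs0"
  have xs: "set xs = W" "distinct xs" "sorted (map v xs)" "length xs = card W"
    using xs0 by (auto simp: xs_def distinct_card[symmetric])
  define rk where "rk = the_inv_into {..<length xs} ((!) xs)"
  have b: "bij_betw ((!) xs) {..<length xs} W" using bij_betw_nth[OF xs(2)] xs(1) by auto
  show ?thesis
  proof (intro exI conjI ballI impI)
    show "bij_betw rk W {..<card W}" using bij_betw_the_inv_into[OF b] xs(4) by (simp add: rk_def)
    then have less: "rk b < length xs" if "b \<in> W" for b using that xs(4) by (auto simp: bij_betw_def)
    have nth: "xs ! rk b = b" if "b \<in> W" for b
      unfolding rk_def by (rule f_the_inv_into_f_bij_betw[OF b]) (use that in auto)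
    fix b b' assume bb: "b \<in> W" "b' \<in> W" "v b < v b'"
    show "rk b < rk b'"
    proof (rule ccontr)
      assume "\<not> rk b < rk b'"
      then have "map v xs ! rk b' \<le> map v xs ! rk b"
        by (intro sorted_nth_mono xs) (use less bb in auto)
      then show False using less bb nth by simp
    qed
  qed
qed

lemma self_coll_div_le:
  assumes "finite W" "inj_on rk W" "s > 0"
  shows "self_coll W (\<lambda>b. rk b div s :: nat) \<le> card W * s"
proof -
  have "{(p, q). p \<in> W \<and> q \<in> W \<and> rk p div s = rk q div s}
     = (SIGMA p:W. {q\<in>W. rk q div s = rk p div s})" by auto
  then have "self_coll W (\<lambda>b. rk b div s) = (\<Sum>p\<in>W. card {q\<in>W. rk q div s = rk p div s})"
    unfolding coll_def using assms(1) by simp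
  also have "\<dots> \<le> (\<Sum>p\<in>W. s)"
  proof (rule sum_mono)
    fix p
    have "card {q\<in>W. rk q div s = rk p div s} \<le> card {rk p div s * s..<rk p div s * s + s}"
    proof (rule card_inj_on_le[where f = rk])
      show "inj_on rk {q\<in>W. rk q div s = rk p div s}" using assms(2) by (auto simp: inj_on_def)
      show "rk ` {q\<in>W. rk q div s = rk p div s} \<subseteq> {rk p div s * s..<rk p div s * s + s}"
      proof clarify
        fix q assume q: "rk q div s = rk p div s"
        have "rk q = rk q div s * s + rk q mod s" "rk q mod s < s" using assms(3) by simp_all
        then show "rk q \<in> {rk p div s * s..<rk p div s * s + s}"
          unfolding q atLeastLessThan_iff by linarith
      qed
    qed simp
    then show "card {q\<in>W. rk q div s = rk p div s} \<le> s" by simp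
  qed
  finally show ?thesis by simp
qed

abbreviation strictly_monotone :: "real set \<Rightarrow> (real \<Rightarrow> real) \<Rightarrow> bool" where
  "strictly_monotone S f \<equiv> strict_mono_on S f \<or> strict_antimono_on S f"

text \<open>On the curve \<open>f i + v b = x\<close> with \<open>f\<close> increasing, a larger
  \<open>i\<close> forces a smaller \<open>v b\<close>, hence no larger block. The cells met thus
  form a descending staircase, on which \<open>\<alpha> + (B - \<beta>)\<close> is injective; for
  decreasing \<open>f\<close> the staircase ascends and \<open>\<alpha> + \<beta>\<close> is
  used.\<close>

lemma staircase:
  fixes f :: "real \<Rightarrow> real" and v :: "'a \<Rightarrow> real" and eb :: "real \<Rightarrow> nat" and blk :: "'a \<Rightarrow> nat"
  assumes f: "strictly_monotone S f"
    and eb: "\<And>i j. i \<le> j \<Longrightarrow> eb i \<le> eb j" and ebA: "\<And>i. eb i \<le> A"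
    and blk: "\<And>b b'. b \<in> W \<Longrightarrow> b' \<in> W \<Longrightarrow> v b < v b' \<Longrightarrow> blk b \<le> blk b'"
    and blkB: "\<And>b. b \<in> W \<Longrightarrow> blk b \<le> B"
  shows "card ((\<lambda>(i, b). (eb i, blk b)) ` {(i, b). i \<in> S \<and> b \<in> W \<and> f i + v b = x}) \<le> A + B + 1"
    (is "card ?C \<le> _")
  using f
proof
  assume mono: "strict_mono_on S f"
  let ?h = "\<lambda>(\<alpha>, \<beta>). \<alpha> + (B - \<beta>)"
  have key: "blk b' \<le> blk b" if "i \<in> S" "i' \<in> S" "b \<in> W" "b' \<in> W" "f i + v b = x" "f i' + v b' = x"
    "eb i < eb i'" for i i' b b'
  proof -
    have "i < i'" using that(7) eb[of i' i] by (meson linorder_not_less)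
    then have "f i < f i'" using mono that by (auto simp: strict_mono_on_def)
    then show ?thesis using blk that by auto
  qed
  have "card ?C \<le> card {..A + B}"
  proof (rule card_inj_on_le[where f = ?h])
    show "inj_on ?h ?C"
    proof (rule inj_onI, clarify)
      fix i b i' b' assume h: "i \<in> S" "b \<in> W" "i' \<in> S" "b' \<in> W" "f i' + v b' = f i + v b"
        and x: "x = f i + v b" and eq: "eb i + (B - blk b) = eb i' + (B - blk b')"
      have x': "f i' + v b' = x" by (simp only: h x)
      have "eb i < eb i' \<Longrightarrow> blk b' \<le> blk b" "eb i' < eb i \<Longrightarrow> blk b \<le> blk b'"
        using key[OF h(1,3,2,4) x[symmetric] x'] key[OF h(3,1,4,2) x' x[symmetric]] by blast+
      with eq blkB[OF h(2)] blkB[OF h(4)] show "eb i = eb i' \<and> blk b = blk b'" by linarith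
    qed
      show "?h ` ?C \<subseteq> {..A + B}" using ebA by (auto intro!: add_mono)
  qed simp
  then show ?thesis by simp
next
  assume mono: "strict_antimono_on S f"
  let ?h = "\<lambda>(\<alpha>, \<beta>). \<alpha> + \<beta>"
  have key: "blk b \<le> blk b'" if "i \<in> S" "i' \<in> S" "b \<in> W" "b' \<in> W" "f i + v b = x" "f i' + v b' = x"
    "eb i < eb i'" for i i' b b'
  proof -
    have "i < i'" using that(7) eb[of i' i] by (meson linorder_not_less)
    then have "f i' < f i" using mono that by (auto simp: monotone_on_def)
    then show ?thesis using blk that by auto
  qed
  have "card ?C \<le> card {..A + B}"
  proof (rule card_inj_on_le[where f = ?h])
    show "inj_on ?h ?C"
    proof (rule inj_onI, clarify)
      fix i b i' b' assume h: "i \<in> S" "b \<in> W" "i' \<in> S" "b' \<in> W" "f i' + v b' = f i + v b"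
        and x: "x = f i + v b" and eq: "eb i + blk b = eb i' + blk b'"
      have x': "f i' + v b' = x" by (simp only: h x)
      have "eb i < eb i' \<Longrightarrow> blk b \<le> blk b'" "eb i' < eb i \<Longrightarrow> blk b' \<le> blk b"
        using key[OF h(1,3,2,4) x[symmetric] x'] key[OF h(3,1,4,2) x' x[symmetric]] by blast+
      with eq show "eb i = eb i' \<and> blk b = blk b'" by linarith
    qed
      show "?h ` ?C \<subseteq> {..A + B}" using ebA blkB by (auto intro!: add_mono)
  qed simp
  then show ?thesis by simp
qed

lemma staircase2:
  fixes f :: "real \<Rightarrow> real" and v :: "'a \<Rightarrow> real" and eb :: "real \<Rightarrow> nat" and blk :: "'a \<Rightarrow> nat"
  assumes f: "strictly_monotone S1 f" "strictly_monotone S2 f" "S = S1 \<union> S2"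
    and eb: "\<And>i j. i \<le> j \<Longrightarrow> eb i \<le> eb j" "\<And>i. eb i \<le> A"
    and blk: "\<And>b b'. b \<in> W \<Longrightarrow> b' \<in> W \<Longrightarrow> v b < v b' \<Longrightarrow> blk b \<le> blk b'" "\<And>b. b \<in> W \<Longrightarrow> blk b \<le> B"
  shows "card ((\<lambda>(i, b). (eb i, blk b)) ` {(i, b). i \<in> S \<and> b \<in> W \<and> f i + v b = x}) \<le> 2 * (A + B + 1)"
proof -
  let ?C = "\<lambda>S. (\<lambda>(i, b). (eb i, blk b)) ` {(i, b). i \<in> S \<and> b \<in> W \<and> f i + v b = x}"
  have "?C S = ?C S1 \<union> ?C S2" by (auto simp: f(3))
  then have "card (?C S) \<le> card (?C S1) + card (?C S2)" by (simp add: card_Un_le)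
  also have "\<dots> \<le> (A + B + 1) + (A + B + 1)"
    by (rule add_mono; rule staircase) (fact f eb blk)+
  finally show ?thesis by simp
qed

text \<open>If \<open>i\<close>, \<open>i'\<close> realise the largest difference in \<open>D\<close>, then \<open>d \<mapsto> i + d\<close> embeds \<open>D\<close> into
  the part of \<open>I + I - I\<close> between \<open>i\<close> and \<open>i'\<close>, which is short by the choice of the blocks.\<close>

lemma card_close_differences:
  assumes fin: "finite I" and H: "H > 0"
  defines "E \<equiv> sum_diff_set I"
  defines "eb \<equiv> \<lambda>i. card {e\<in>E. e < i} div H"
  defines "D \<equiv> {i' - i | i i'. i \<in> I \<and> i' \<in> I \<and> i < i' \<and> eb i = eb i'}"
  shows "finite D" "card D \<le> H"
proof -
  have "D \<subseteq> (\<lambda>(i', i). i' - i) ` (I \<times> I)" by (force simp: D_def)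
  then show finD: "finite D" by (rule finite_subset) (use fin in auto)
  have "E \<subseteq> (\<lambda>(i, j, k). i + j - k) ` (I \<times> I \<times> I)" by (force simp: E_def sum_diff_set_def)
  then have finE: "finite E" by (rule finite_subset) (use fin in auto)
  show "card D \<le> H"
  proof (cases "D = {}")
    case False
    then have "Max D \<in> D" using finD by simp
    then obtain i i' where i: "i \<in> I" "i' \<in> I" "i < i'" "eb i = eb i'" "Max D = i' - i" by (auto simp: D_def)
    have IE: "j \<in> E" if "j \<in> I" for j unfolding E_def sum_diff_set_def using that by force
    have "card D \<le> card {e\<in>E. i < e \<and> e \<le> i'}"
    proof (rule card_inj_on_le[where f = "\<lambda>d. i + d"])
      show "(\<lambda>d. i + d) ` D \<subseteq> {e\<in>E. i < e \<and> e \<le> i'}"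
      proof clarify
        fix d assume d: "d \<in> D"
        then obtain j j' where j: "j \<in> I" "j' \<in> I" "j < j'" "d = j' - j" by (auto simp: D_def)
        have "d \<le> i' - i" using Max_ge[OF finD d] i(5) by simp
        moreover have "i + d \<in> E" unfolding E_def sum_diff_set_def using i j by force
        ultimately show "i + d \<in> E \<and> i < i + d \<and> i + d \<le> i'" using j by auto
      qed
    qed (use finE in \<open>auto simp: inj_on_def\<close>)
    \<comment> \<open>Exchanging the endpoint \<open>i'\<close> for \<open>i\<close> gives a
      half-open segment, the difference of the two initial segments whose sizes \<open>eb\<close>
      divides by \<open>H\<close>. This yields \<open>H\<close> rather than
      \<open>H + 1\<close>.\<close>
    also have "\<dots> \<le> card (insert i' {e\<in>E. i < e \<and> e < i'})"
      by (rule card_mono) (use finE in auto)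
    also have "\<dots> = Suc (card {e\<in>E. i < e \<and> e < i'})" using finE by simp
    also have "\<dots> = card (insert i {e\<in>E. i < e \<and> e < i'})" using finE by simp
    also have "insert i {e\<in>E. i < e \<and> e < i'} = {e\<in>E. e < i'} - {e\<in>E. e < i}"
      using i IE by auto
    also have "card \<dots> = card {e\<in>E. e < i'} - card {e\<in>E. e < i}"
      by (rule card_Diff_subset) (use finE i in auto)
    also have "\<dots> \<le> H"
    proof -
      have "a - b \<le> H" if "a div H = b div H" for a b
      proof -
        have "a = a div H * H + a mod H" "b = b div H * H + b mod H" "a mod H < H" using H by simp_all
        then show ?thesis unfolding that by linarith
      qed
      then show ?thesis using i by (simp add: eb_def)
    qed
    finally show ?thesis .
  qed simp
qed

section \<open>Same-cell solutions and difference functions\<close>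

lemma finite_sum_diff_set: "finite I \<Longrightarrow> finite (sum_diff_set I)"
  by (rule finite_subset[of _ "(\<lambda>(i, j, k). i + j - k) ` (I \<times> I \<times> I)"])
     (force simp: sum_diff_set_def)+

definition shift_dom :: "real \<Rightarrow> real set \<Rightarrow> real set" where
  "shift_dom d S = {x\<in>S. x + d \<in> S}"

definition fdiff :: "real \<Rightarrow> (real \<Rightarrow> real) \<Rightarrow> real \<Rightarrow> real" where
  "fdiff d f x = f (x + d) - f x"

text \<open>The diagonal \<open>i = i'\<close> gives the first term. For \<open>i < i'\<close> put
  \<open>d = i' - i\<close>; the equation becomes \<open>v b = v b' + fdiff d f i\<close> with
  \<open>b\<close>, \<open>b'\<close> in one block. The case \<open>i' < i\<close> follows by
  exchanging the two sides.\<close>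

lemma self_coll_same_cell_le:
  fixes f :: "real \<Rightarrow> real" and v :: "'a \<Rightarrow> real"
  assumes fin: "finite S" "finite W" "finite D"
    and D: "\<And>i i'. i \<in> S \<Longrightarrow> i' \<in> S \<Longrightarrow> i < i' \<Longrightarrow> eb i = eb i' \<Longrightarrow> i' - i \<in> D"
    and F: "\<And>d. d \<in> D \<Longrightarrow> coll W (\<lambda>b. (blk b, v b)) (shift_dom d S \<times> W)
              (\<lambda>(i, b). (blk b, v b + fdiff d f i)) \<le> F"
  shows "self_coll (S \<times> W) (\<lambda>p. (case p of (i, b) \<Rightarrow> f i + v b, case p of (i, b) \<Rightarrow> (eb i, blk b)))
     \<le> card S * self_coll W v + 2 * (card D * F)"
proof -
  let ?A = "{((i, b), (i', b')). i \<in> S \<and> b \<in> W \<and> i' \<in> S \<and> b' \<in> W \<and>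
      f i + v b = f i' + v b' \<and> eb i = eb i' \<and> blk b = blk b'}"
  let ?Az = "{((i, b), (i', b')) \<in> ?A. i = i'}"
  let ?A1 = "{((i, b), (i', b')) \<in> ?A. i < i'}"
  let ?A2 = "{((i, b), (i', b')) \<in> ?A. i' < i}"
  let ?G = "\<lambda>d. {(b, q). b \<in> W \<and> q \<in> shift_dom d S \<times> W \<and>
      (blk b, v b) = (case q of (i, b) \<Rightarrow> (blk b, v b + fdiff d f i))}"
  let ?V = "{(b, b'). b \<in> W \<and> b' \<in> W \<and> v b = v b'}"
  have finA: "finite ?A" by (rule finite_subset[of _ "(S \<times> W) \<times> (S \<times> W)"]) (use fin in auto)
  have finG: "finite (?G d)" for d
    using fin by (intro finite_coll_set) (auto simp: shift_dom_def)
  have finV: "finite ?V" using fin by (intro finite_coll_set) auto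
  have "card ?Az \<le> card (S \<times> ?V)"
    by (rule card_inj_on_le[where f = "\<lambda>((i, b), (i', b')). (i, (b, b'))"])
       (use fin finV in \<open>auto simp: inj_on_def\<close>)
  then have 0: "card ?Az \<le> card S * self_coll W v" by (simp add: card_cartesian_product coll_def)
  have "card ?A1 \<le> card (SIGMA d:D. ?G d)"
  proof (rule card_inj_on_le[where f = "\<lambda>((i, b), (i', b')). (i' - i, (b, (i, b')))"])
    show "(\<lambda>((i, b), (i', b')). (i' - i, (b, (i, b')))) ` ?A1 \<subseteq> (SIGMA d:D. ?G d)"
      using D by (auto simp: shift_dom_def fdiff_def)
  qed (use fin finG in \<open>auto simp: inj_on_def\<close>)
  also have "\<dots> = (\<Sum>d\<in>D. card (?G d))" by (rule card_SigmaI) (use fin finG in auto)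
  also have "\<dots> \<le> (\<Sum>d\<in>D. F)" by (rule sum_mono) (use F in \<open>simp add: coll_def\<close>)
  finally have 1: "card ?A1 \<le> card D * F" by simp
  have "card ?A2 \<le> card ?A1"
  proof (rule card_inj_on_le[where f = "\<lambda>(p, q). (q, p)"])
    show "finite ?A1" by (rule finite_subset[OF _ finA]) auto
  qed (auto simp: inj_on_def)
  with 1 have 2: "card ?A2 \<le> card D * F" by simp
  have "card ?A = card (?Az \<union> (?A1 \<union> ?A2))" by (rule arg_cong[where f = card]) auto
  also have "\<dots> \<le> card ?Az + card (?A1 \<union> ?A2)" by (rule card_Un_le)
  also have "\<dots> \<le> card ?Az + (card ?A1 + card ?A2)" by (intro add_left_mono card_Un_le)
  also have "\<dots> \<le> card S * self_coll W v + 2 * (card D * F)" using 0 1 2 by simp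
  finally have "card ?A \<le> card S * self_coll W v + 2 * (card D * F)" .
  moreover have "self_coll (S \<times> W) (\<lambda>p. (case p of (i, b) \<Rightarrow> f i + v b, case p of (i, b) \<Rightarrow> (eb i, blk b)))
     \<le> card ?A"
    unfolding coll_def by (rule card_mono[OF finA]) auto
  ultimately show ?thesis by (rule order_trans[rotated])
qed

text \<open>The first factor bounds the number of cells on a curve, the second the same-cell
  solutions. \<open>F\<close> bounds the solutions for each difference \<open>d\<close>;
  constraining its power instead of defining it avoids roots.\<close>

lemma energy_Suc_le_blocks:
  fixes f :: "real \<Rightarrow> real" and H s :: nat and F \<tau> :: real
  assumes fin: "finite I" and S: "S \<subseteq> I" and pos: "H > 0" "s > 0"
    and f: "strictly_monotone S1 f" "strictly_monotone S2 f" "S = S1 \<union> S2"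
    and tau: "\<And>d. d > 0 \<Longrightarrow> real (energy (2 ^ j) (shift_dom d S) (fdiff d f)) \<le> \<tau>"
    and F: "F \<ge> 0" "real (energy m S f) ^ (2 * 2 ^ j - 1) * (\<tau> * (real (card S) ^ m * real s)) \<le> F ^ (2 * 2 ^ j)"
  shows "real (energy (Suc m) S f)
    \<le> 2 * (real (card (sum_diff_set I)) / H + real (card S) ^ m / s + 1)
        * (real (card S) * energy m S f + 2 * (H * F))"
proof -
  have finS: "finite S" using fin S finite_subset by blast
  define E where "E = sum_diff_set I"
  have finE: "finite E" unfolding E_def using fin by (rule finite_sum_diff_set)
  define W where "W = tup m S"
  define v where "v = (\<lambda>b. sumf f b)"
  have finW: "finite W" and cardW: "card W = card S ^ m"
    using finS by (auto simp: W_def card_tup)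
  have enW: "self_coll W v = energy m S f" by (simp add: W_def v_def energy_def)
  obtain rk where rk: "bij_betw rk W {..<card W}"
    "\<And>b b'. b \<in> W \<Longrightarrow> b' \<in> W \<Longrightarrow> v b < v b' \<Longrightarrow> rk b < rk b'"
    using exists_rank[OF finW, of v] by blast
  define blk where "blk = (\<lambda>b. rk b div s)"
  define eb where "eb = (\<lambda>i. card {e\<in>E. e < i} div H)"
  define D where "D = {i' - i | i i'. i \<in> I \<and> i' \<in> I \<and> i < i' \<and> eb i = eb i'}"
  have D: "finite D" "card D \<le> H"
    using card_close_differences[OF fin pos(1)] by (simp_all add: D_def eb_def E_def)
  let ?A = "card E div H" and ?B = "card W div s"
  let ?c = "\<lambda>(i, b). (eb i, blk b)" and ?v = "\<lambda>(i, b). f i + v b"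
  have cells: "card (?c ` {p\<in>S \<times> W. ?v p = x}) \<le> 2 * (?A + ?B + 1)" for x
  proof -
    have "card (?c ` {(i, b). i \<in> S \<and> b \<in> W \<and> f i + v b = x}) \<le> 2 * (?A + ?B + 1)"
    proof (rule staircase2[OF f])
      show "eb i \<le> eb j" if "i \<le> j" for i j
        unfolding eb_def by (intro div_le_mono card_mono) (use finE that in auto)
      show "eb i \<le> ?A" for i
        unfolding eb_def by (intro div_le_mono card_mono) (use finE in auto)
      show "blk b \<le> blk b'" if "b \<in> W" "b' \<in> W" "v b < v b'" for b b'
        unfolding blk_def by (intro div_le_mono less_imp_le rk that)
      show "blk b \<le> ?B" if "b \<in> W" for b
        unfolding blk_def using bij_betwE[OF rk(1)] that by (intro div_le_mono) (simp add: less_imp_le)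
    qed
    also have "{(i, b). i \<in> S \<and> b \<in> W \<and> f i + v b = x} = {p\<in>S \<times> W. ?v p = x}" by auto
    finally show ?thesis .
  qed
  have Fd: "real (coll W (\<lambda>b. (blk b, v b)) (shift_dom d S \<times> W)
      (\<lambda>(i, b). (blk b, v b + fdiff d f i))) \<le> F" (is "real ?F \<le> F") if "d \<in> D" for d
  proof -
    have "d > 0" using that by (auto simp: D_def)
    have "finite (shift_dom d S)" using finS by (simp add: shift_dom_def)
    note le = coll_power_le[OF this finW, of blk v "fdiff d f" j]
    have "real ?F ^ (2 * 2 ^ j) \<le> real (self_coll W v) ^ (2 * 2 ^ j - 1) *
        (real (energy (2 ^ j) (shift_dom d S) (fdiff d f)) * real (self_coll W blk))"
      using of_nat_mono[OF le, where 'a = real] unfolding of_nat_mult of_nat_power .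
    also have "\<dots> \<le> real (energy m S f) ^ (2 * 2 ^ j - 1) * (\<tau> * (real (card S) ^ m * real s))"
      unfolding enW
    proof (intro mult_left_mono mult_mono tau \<open>d > 0\<close>)
      have le: "self_coll W blk \<le> card W * s"
        unfolding blk_def by (rule self_coll_div_le) (use finW rk(1) pos in \<open>auto simp: bij_betw_def\<close>)
      show "real (self_coll W blk) \<le> real (card S) ^ m * real s"
        using of_nat_mono[OF le, where 'a = real] unfolding cardW of_nat_mult of_nat_power .
      show "0 \<le> \<tau>" using tau[OF \<open>d > 0\<close>] by (rule order_trans[rotated]) simp
    qed auto
    also have "\<dots> \<le> F ^ (2 * 2 ^ j)" by (rule F(2))
    finally show ?thesis using F(1) by (subst (asm) power_mono_iff) auto
  qed
  \<comment> \<open>The quantities bounded by \<open>F\<close> are integers, so rounding down is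
    harmless.\<close>
  let ?F = "nat \<lfloor>F\<rfloor>"
  have "energy (Suc m) S f \<le> self_coll (S \<times> W) ?v"
    using energy_Suc_le_self_coll[OF finS, of m f] by (simp add: W_def v_def)
  also have "\<dots> \<le> 2 * (?A + ?B + 1) * self_coll (S \<times> W) (\<lambda>p. (?v p, ?c p))"
    by (rule self_coll_le_cells) (use finS finW cells in auto)
  also have "\<dots> \<le> 2 * (?A + ?B + 1) * (card S * self_coll W v + 2 * (card D * ?F))"
  proof (rule mult_left_mono[OF self_coll_same_cell_le[OF finS finW D(1)]])
    show "i' - i \<in> D" if "i \<in> S" "i' \<in> S" "i < i'" "eb i = eb i'" for i i'
      using that S by (auto simp: D_def)
  qed (use Fd in \<open>auto simp: le_nat_floor\<close>)
  finally have "real (energy (Suc m) S f) \<le>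
      real (2 * (?A + ?B + 1) * (card S * self_coll W v + 2 * (card D * ?F)))"
    by (simp only: of_nat_le_iff)
  also have "\<dots> = 2 * (real ?A + real ?B + 1) * (real (card S) * self_coll W v + 2 * (real (card D) * real ?F))"
    by (simp only: of_nat_mult of_nat_add of_nat_numeral of_nat_1)
  also have "\<dots> \<le> 2 * (real (card E) / H + real (card S) ^ m / s + 1)
        * (real (card S) * energy m S f + 2 * (H * F))"
  proof (intro mult_mono add_mono order_refl)
    show "real ?A \<le> real (card E) / H" by (rule of_nat_div_le_of_nat)
    have "real ?B \<le> real (card W) / s" by (rule of_nat_div_le_of_nat)
    then show "real ?B \<le> real (card S) ^ m / s" by (simp add: cardW)
    show "real (card D) \<le> H" "real ?F \<le> F" using D F(1) by auto
  qed (auto simp: enW F(1))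
  finally show ?thesis by (simp add: E_def)
qed

section \<open>Gain per finite difference\<close>

text \<open>Normalising by \<open>card I\<close> instead of \<open>card S\<close> keeps a single
  scale when \<open>S\<close> is replaced by its subsets \<open>shift_dom d S\<close>.\<close>

lemma energy_mono_step:
  assumes "finite I" "S \<subseteq> I"
  shows "real (energy (Suc m) S f) / real (card I) ^ (2 * Suc m) \<le> real (energy m S f) / real (card I) ^ (2 * m)"
proof (cases "card I = 0")
  case False
  have "card S \<le> card I" using assms by (rule card_mono)
  then have "energy (Suc m) S f \<le> (card I)\<^sup>2 * energy m S f"
    using energy_Suc_le[OF finite_subset[OF assms(2,1)], of m f]
    by (meson le_trans mult_le_mono1 power_mono zero_le)
  then have "real (energy (Suc m) S f) \<le> (real (card I))\<^sup>2 * real (energy m S f)"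
    by (metis of_nat_le_iff of_nat_mult of_nat_power)
  then show ?thesis using False by (simp add: field_simps power2_eq_square)
next
  case True
  then have "I = {}" using assms by simp
  then show ?thesis using assms by (simp add: energy_def coll_def tup_def power_0_left)
qed

lemma energy_antimono:
  assumes "finite I" "S \<subseteq> I" "m \<le> n"
  shows "real (energy n S f) / real (card I) ^ (2 * n) \<le> real (energy m S f) / real (card I) ^ (2 * m)"
  using assms(3)
proof (induction rule: dec_induct)
  case (step n)
  then show ?case using energy_mono_step[OF assms(1,2), of n f] by linarith
qed simp

lemma energy_0: "energy 0 S f = 1"
proof -
  have "{(p, q). p \<in> tup 0 S \<and> q \<in> tup 0 S \<and> sumf f p = sumf f q} = {([], [])}"
    by (auto simp: tup_def)
  then show ?thesis by (simp add: energy_def coll_def)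
qed

text \<open>The block lengths \<open>H \<approx> 12 K q\<close> in \<open>E\<close> and \<open>s \<approx> N\<^sup>m H / (K N)\<close> among the sums are chosen so that the
  diagonal \<open>i = i'\<close> and the off-diagonal solutions each contribute at most \<open>t / (2 q)\<close>.\<close>

lemma energy_step:
  fixes f :: "real \<Rightarrow> real" and q \<tau> :: real
  assumes fin: "finite I" and S: "S \<subseteq> I" and m: "m \<ge> 1"
    and f: "strictly_monotone S1 f" "strictly_monotone S2 f" "S = S1 \<union> S2"
    and tau: "\<And>d. d > 0 \<Longrightarrow> real (energy (2 ^ j) (shift_dom d S) (fdiff d f)) \<le> real (card I) ^ (2 * 2 ^ j) * \<tau>"
    and N: "N = real (card I)" "N > 0" and K: "real (card (sum_diff_set I)) = K * N" "K \<ge> 1"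
    and q: "q \<ge> 1" "13 * q \<le> N"
    and t: "t = real (energy m S f) / N ^ (2 * m)" "t > 0"
    and Q: "\<tau> * (26 * q / N) * (24 * K * q) ^ (2 * 2 ^ j) \<le> t"
  shows "real (energy (Suc m) S f) / N ^ (2 * Suc m) \<le> t / q"
proof -
  define H where "H = nat \<lceil>12 * K * q\<rceil>"
  have Kq: "K * q \<ge> 1" using K q by (metis mult_mono mult_1 zero_le_one order_trans)
  have H: "real H \<ge> 12 * K * q" "real H \<le> 13 * K * q" "H > 0"
    using Kq unfolding H_def by linarith+
  have Hpos: "real H > 0" using H(3) by simp
  have HKN: "real H \<le> K * N"
  proof -
    have "K * (13 * q) \<le> K * N" using q K by (intro mult_left_mono) auto
    then show ?thesis using H(2) by (simp add: mult_ac)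
  qed
  have KH: "K \<le> real H"
  proof -
    have "K * 1 \<le> K * q" using q K by (intro mult_left_mono) auto
    then show ?thesis using H(1) Kq by (simp add: mult_ac)
  qed
  define s where "s = nat \<lceil>N ^ m * H / (K * N)\<rceil>"
  have N1: "N \<ge> 1" using N by simp
  have s0: "N ^ m * H / (K * N) \<ge> 1"
  proof -
    have "K * N \<le> H * N ^ m"
      using N1 m KH K by (intro mult_mono) (auto intro: self_le_power)
    then show ?thesis using K N by (simp add: field_simps)
  qed
  have s: "real s \<ge> N ^ m * H / (K * N)" "real s \<le> 2 * (N ^ m * H / (K * N))" "s > 0"
    using s0 unfolding s_def by linarith+
  \<comment> \<open>With at most \<open>6 * K * N / H\<close> cells, the off-diagonal term
    \<open>2 * H * F\<close> becomes \<open>12 * K * N * F\<close>, which for this \<open>F\<close>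
    is exactly \<open>N ^ (2 * m + 2) * t / (2 * q)\<close>.\<close>
  define F where "F = N ^ (2 * m + 1) * t / (24 * K * q)"
  have SN: "real (card S) \<le> N" using card_mono[OF fin S] N by simp
  have tau0: "\<tau> \<ge> 0"
  proof -
    have "0 \<le> real (card I) ^ (2 * 2 ^ j) * \<tau>" using tau[of 1] by (rule order_trans[rotated]) simp_all
    moreover have "real (card I) ^ (2 * 2 ^ j) > 0" using N by simp
    ultimately show ?thesis unfolding zero_le_mult_iff by linarith
  qed
  have enm: "real (energy m S f) = N ^ (2 * m) * t" using t N by simp
  \<comment> \<open>The factor \<open>26 * q / N\<close> in \<open>Q\<close> bounds the relative
    block length \<open>s / N ^ m\<close>: rounding up costs at most a factor 2 in \<open>s\<close>
    and turns 12 into at most 13 in \<open>H\<close>.\<close>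
  have Feq: "real (energy m S f) ^ (2 * 2 ^ j - 1) * (N ^ (2 * 2 ^ j) * \<tau> * (real (card S) ^ m * real s)) \<le> F ^ (2 * 2 ^ j)"
  proof -
    define n where "n = 2 * 2 ^ j - (1::nat)"
    have n: "2 * 2 ^ j = Suc n" unfolding n_def by simp
    have "N ^ (2 * 2 ^ j) * \<tau> * (real (card S) ^ m * real s) \<le>
       N ^ (2 * 2 ^ j) * \<tau> * (N ^ m * (2 * (N ^ m * H / (K * N))))"
      using SN N1 tau0 s by (intro mult_left_mono mult_mono power_mono) auto
    also have "\<dots> \<le> N ^ (2 * 2 ^ j) * \<tau> * (N ^ m * (2 * (N ^ m * (13 * K * q) / (K * N))))"
      using N1 tau0 K H by (intro mult_left_mono divide_right_mono) auto
    also have "\<dots> = N ^ (2 * 2 ^ j) * N ^ (2 * m) * (\<tau> * (26 * q / N))"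
    proof -
      have "N ^ (2 * m) = N ^ m * N ^ m" by (simp add: mult_2 power_add)
      then show ?thesis using K(2) N(2) by (simp add: field_simps)
    qed
    finally have 1: "N ^ (2 * 2 ^ j) * \<tau> * (real (card S) ^ m * real s)
       \<le> N ^ (2 * 2 ^ j) * N ^ (2 * m) * (\<tau> * (26 * q / N))" .
    have y: "24 * K * q > 0" using Kq by simp
    have 2: "\<tau> * (26 * q / N) \<le> t / (24 * K * q) ^ (2 * 2 ^ j)"
      using Q y by (simp add: pos_le_divide_eq)
    have "real (energy m S f) ^ n * (N ^ (2 * 2 ^ j) * \<tau> * (real (card S) ^ m * real s))
      \<le> (N ^ (2 * m) * t) ^ n * (N ^ (2 * 2 ^ j) * N ^ (2 * m) * (t / (24 * K * q) ^ (2 * 2 ^ j)))"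
      unfolding enm using 1 2 t N1
      by (intro mult_left_mono order_trans[OF 1] mult_left_mono) auto
    also have "\<dots> = F ^ (2 * 2 ^ j)"
      unfolding F_def n by (simp add: power_divide power_mult_distrib field_simps)
    finally show ?thesis unfolding n_def .
  qed
  have F0: "F \<ge> 0" unfolding F_def using N1 t K q by simp
  have "real (energy (Suc m) S f) \<le> 2 * (real (card (sum_diff_set I)) / H + real (card S) ^ m / s + 1)
        * (real (card S) * energy m S f + 2 * (H * F))"
    using energy_Suc_le_blocks[OF fin S H(3) s(3) f tau F0] Feq by (simp add: N)
  \<comment> \<open>Each of the three summands in the cell count is at most
    \<open>K * N / H\<close>; for the summand 1 this is \<open>HKN\<close>, which comes from
    \<open>13 * q \<le> N\<close>.\<close>
  also have "\<dots> \<le> (6 * (K * N) / H) * (N * (N ^ (2 * m) * t) + 2 * (H * F))"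
  proof (intro mult_mono)
    have "real (card S) ^ m / s \<le> N ^ m / (N ^ m * H / (K * N))"
      using SN N1 s s0 by (intro frac_le power_mono) auto
    also have "\<dots> = K * N / H" using N1 by simp
    finally have "real (card S) ^ m / s \<le> K * N / H" .
    moreover have "1 \<le> K * N / H" using HKN Hpos by simp
    ultimately show "2 * (real (card (sum_diff_set I)) / H + real (card S) ^ m / s + 1) \<le> 6 * (K * N) / H"
      unfolding K(1) by simp
    show "real (card S) * energy m S f + 2 * (H * F) \<le> N * (N ^ (2 * m) * t) + 2 * (H * F)"
      unfolding enm using SN t N1 by (intro add_right_mono mult_right_mono) auto
  qed (use K N Hpos F0 in auto)
  also have "\<dots> = N ^ (2 * Suc m) * t * (6 * K / H + 12 * K / (24 * K * q))"
    unfolding F_def using Hpos K q by (simp add: field_simps power2_eq_square)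
  also have "\<dots> \<le> N ^ (2 * Suc m) * t * (1 / q)"
  proof (intro mult_left_mono)
    have "6 * K / H \<le> 6 * K / (12 * K * q)" using H(1) Kq K by (intro divide_left_mono) auto
    also have "\<dots> = 1 / (2 * q)" using K q by simp
    finally have "6 * K / H \<le> 1 / (2 * q)" .
    moreover have "12 * K / (24 * K * q) = 1 / (2 * q)" using K q by simp
    moreover have "1 / (2 * q) + 1 / (2 * q) = 1 / q" by simp
    ultimately show "6 * K / H + 12 * K / (24 * K * q) \<le> 1 / q" by linarith
  qed (use t N1 in auto)
  finally show ?thesis using N1 by (simp add: field_simps)
qed

text \<open>Each new summand divides the normalised energy by \<open>q\<close> as long as it is
  above the threshold of \<open>energy_step\<close>. Once it is at or below the threshold,
  monotonicity keeps it there.\<close>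

lemma energy_iterate:
  fixes f :: "real \<Rightarrow> real" and q \<tau> :: real
  assumes fin: "finite I" and S: "S \<subseteq> I"
    and f: "strictly_monotone S1 f" "strictly_monotone S2 f" "S = S1 \<union> S2"
    and tau: "\<And>d. d > 0 \<Longrightarrow> real (energy (2 ^ j) (shift_dom d S) (fdiff d f)) \<le> real (card I) ^ (2 * 2 ^ j) * \<tau>"
    and N: "N = real (card I)" "N > 0" and K: "real (card (sum_diff_set I)) = K * N" "K \<ge> 1"
    and q: "q \<ge> 1" "13 * q \<le> N" and m: "m \<ge> 1"
    and base: "real (energy m S f) / N ^ (2 * m) \<le> \<tau>"
  shows "real (energy (m + n) S f) / N ^ (2 * (m + n))
    \<le> max (\<tau> * (26 * q / N) * (24 * K * q) ^ (2 * 2 ^ j)) (\<tau> / q ^ n)"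
proof (induction n)
  case 0
  then show ?case using base by simp
next
  case (Suc n)
  let ?Q = "\<tau> * (26 * q / N) * (24 * K * q) ^ (2 * 2 ^ j)"
  define t where "t = real (energy (m + n) S f) / N ^ (2 * (m + n))"
  have dec: "real (energy (m + Suc n) S f) / N ^ (2 * (m + Suc n)) \<le> t"
    using energy_mono_step[OF fin S, of "m + n" f] by (simp add: t_def N)
  show ?case
  proof (cases "?Q \<le> t \<and> t > 0")
    case True
    have "real (energy (Suc (m + n)) S f) / N ^ (2 * Suc (m + n)) \<le> t / q"
      by (rule energy_step[OF fin S _ f tau N K q t_def]) (use True m in auto)
    moreover have "t / q \<le> max ?Q (\<tau> / q ^ Suc n)"
    proof (cases "t \<le> \<tau> / q ^ n")
      case True
      then have "t / q \<le> \<tau> / q ^ n / q" using q by (intro divide_right_mono) auto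
      then show ?thesis by (simp add: mult.commute)
    next
      case False
      then have "t \<le> ?Q" using Suc unfolding t_def[symmetric] by linarith
      moreover have "t / q \<le> t" using \<open>?Q \<le> t \<and> t > 0\<close> q by (simp add: field_simps)
      ultimately show ?thesis by linarith
    qed
    ultimately show ?thesis by simp
  next
    case False
    have "t \<ge> 0" unfolding t_def using N by simp
    moreover have "\<tau> \<ge> 0" using base by (rule order_trans[rotated]) (use N in simp)
    then have "0 \<le> \<tau> / q ^ Suc n" using q by simp
    ultimately show ?thesis using False dec by linarith
  qed
qed

text \<open>The only consequence of convexity that the argument needs, with no reference to an interval.
  The two pieces are needed because \<open>f\<close> itself need not be monotone.\<close>

fun fd_convex :: "nat \<Rightarrow> real set \<Rightarrow> (real \<Rightarrow> real) \<Rightarrow> bool" where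
  "fd_convex 0 S f \<longleftrightarrow> True"
| "fd_convex (Suc k) S f \<longleftrightarrow>
     (\<exists>S1 S2. S = S1 \<union> S2 \<and> strictly_monotone S1 f \<and> strictly_monotone S2 f) \<and>
     (\<forall>d>0. fd_convex k (shift_dom d S) (fdiff d f))"

lemma fd_convex_SucD: "fd_convex (Suc k) S f \<Longrightarrow> fd_convex k S f"
proof (induction k arbitrary: S f)
  case (Suc k)
  from Suc.prems have 1: "\<exists>S1 S2. S = S1 \<union> S2 \<and> strictly_monotone S1 f \<and> strictly_monotone S2 f"
    and 2: "\<forall>d>0. fd_convex (Suc k) (shift_dom d S) (fdiff d f)"
    unfolding fd_convex.simps(2)[of "Suc k"] by blast+
  show ?case unfolding fd_convex.simps(2)[of k] using 1 2 Suc.IH by blast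
qed simp

text \<open>Induction on the order of convexity, from \<open>M = 8 ^ k\<close> to
  \<open>8 * M\<close> summands by \<open>7 * M\<close> further steps. The induction hypothesis is
  used twice: for the difference functions, and for \<open>f\<close> itself as the starting
  bound.\<close>

lemma energy_fd_convex_le:
  assumes fin: "finite I" and N: "N = real (card I)" "N > 0"
    and K: "real (card (sum_diff_set I)) = K * N" "K \<ge> 1"
  shows "S \<subseteq> I \<Longrightarrow> fd_convex k S f \<Longrightarrow> 26 * (24 * K) ^ (2 * 8 ^ k) \<le> N powr (1/8) \<Longrightarrow>
    real (energy (8 ^ k) S f) / N ^ (2 * 8 ^ k) \<le> N powr (- real k / 2)"
proof (induction k arbitrary: S f)
  case 0
  have "real (energy 1 S f) / real (card I) ^ (2 * 1) \<le> real (energy 0 S f) / real (card I) ^ (2 * 0)"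
    by (rule energy_antimono) (use fin 0 in auto)
  then show ?case using N by (simp add: energy_0)
next
  case (Suc k)
  let ?\<tau> = "N powr (- real k / 2)"
  define M :: nat where "M = 8 ^ k"
  have M: "M = 2 ^ (3 * k)" "M \<ge> 1" by (simp_all add: M_def power_mult)
  have K1: "24 * K \<ge> 1" using K by simp
  have "26 * (24 * K) ^ (2 * M) \<le> 26 * (24 * K) ^ (2 * 8 ^ Suc k)"
    unfolding M_def using K1 by (intro mult_left_mono power_increasing) auto
  also have "\<dots> \<le> N powr (1/8)" using Suc.prems by simp
  finally have cond: "26 * (24 * K) ^ (2 * M) \<le> N powr (1/8)" .
  have N1: "N \<ge> 1" using N by simp
  have N26: "26 \<le> N powr (1/8)"
    using cond one_le_power[OF K1, of "2 * M"] by linarith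
  \<comment> \<open>Then \<open>q ^ (7 * M)\<close> is \<open>N powr (7/8)\<close>, while
    \<open>q ^ (2 * M + 1)\<close> is at most \<open>N powr (3/8)\<close>. Together with
    \<open>cond\<close> the threshold is at most \<open>?\<tau> * N powr (1/8 + 3/8 - 1)\<close>, so
    both terms of the maximum save \<open>N powr (1/2)\<close>.\<close>
  define q where "q = N powr (1 / (8 * M))"
  have q1: "q \<ge> 1" unfolding q_def using N1 by (simp add: ge_one_powr_ge_zero)
  have q8: "q \<le> N powr (1/8)" unfolding q_def using N1 M by (intro powr_mono) (auto simp: field_simps)
  have "13 * N powr (1/8) \<le> N powr (1/8) * N powr (7/8)"
  proof -
    have "N powr (1/8) \<le> N powr (7/8)" using N1 by (intro powr_mono) auto
    then have "13 \<le> N powr (7/8)" using N26 by linarith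
    then show ?thesis using mult_right_mono[of 13 "N powr (7/8)" "N powr (1/8)"] by (simp add: mult.commute)
  qed
  also have "\<dots> = N" using N1 by (simp add: powr_add[symmetric])
  finally have "13 * q \<le> N" using q8 by linarith
  obtain S1 S2 where S12: "S = S1 \<union> S2" "strictly_monotone S1 f" "strictly_monotone S2 f"
    using Suc.prems(2) by auto
  have IH: "real (energy M S' g) / N ^ (2 * M) \<le> ?\<tau>" if "S' \<subseteq> I" "fd_convex k S' g" for S' g
    using Suc.IH[OF that] cond by (simp add: M_def)
  have "real (energy (M + 7 * M) S f) / N ^ (2 * (M + 7 * M))
    \<le> max (?\<tau> * (26 * q / N) * (24 * K * q) ^ (2 * 2 ^ (3 * k))) (?\<tau> / q ^ (7 * M))"
  proof (rule energy_iterate[OF fin Suc.prems(1) S12(2,3,1) _ N K q1 \<open>13 * q \<le> N\<close> M(2)])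
    fix d :: real assume "d > 0"
    then have "real (energy M (shift_dom d S) (fdiff d f)) / N ^ (2 * M) \<le> ?\<tau>"
      using Suc.prems by (intro IH) (auto simp: shift_dom_def)
    then show "real (energy (2 ^ (3 * k)) (shift_dom d S) (fdiff d f)) \<le> real (card I) ^ (2 * 2 ^ (3 * k)) * ?\<tau>"
      using N by (simp add: M(1) field_simps)
  next
    show "real (energy M S f) / N ^ (2 * M) \<le> ?\<tau>"
      using Suc.prems fd_convex_SucD by (intro IH) auto
  qed
  also have "\<dots> \<le> ?\<tau> * N powr (-1/2)"
  proof (rule max.boundedI)
    have qp: "q ^ n = N powr (n / (8 * M))" for n
      unfolding q_def using N by (simp add: powr_realpow[symmetric] powr_powr)
    have "q * q ^ (2 * M) = q ^ (2 * M + 1)" by simp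
    also have "\<dots> \<le> N powr (3/8)"
      unfolding qp using N1 M(2) by (intro powr_mono) (auto simp: field_simps)
    finally have q3: "q * q ^ (2 * M) \<le> N powr (3/8)" .
    have "?\<tau> * (26 * q / N) * (24 * K * q) ^ (2 * 2 ^ (3 * k))
        = ?\<tau> * ((26 * (24 * K) ^ (2 * M)) * (q * q ^ (2 * M)) / N)"
      unfolding M(1)[symmetric] by (simp add: power_mult_distrib)
    also have "\<dots> \<le> ?\<tau> * (N powr (1/8) * N powr (3/8) / N)"
      using cond q3 N q1 by (intro mult_left_mono divide_right_mono mult_mono) auto
    also have "\<dots> = ?\<tau> * N powr (-1/2)"
      using N by (simp add: powr_add[symmetric] powr_diff[symmetric] powr_minus field_simps)
    finally show "?\<tau> * (26 * q / N) * (24 * K * q) ^ (2 * 2 ^ (3 * k)) \<le> ?\<tau> * N powr (-1/2)" .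
    have "real (7 * M) / (8 * M) = 7/8" using M(2) by simp
    then have "?\<tau> / q ^ (7 * M) = ?\<tau> * N powr (-(7/8))"
      unfolding qp by (simp only: powr_minus divide_inverse)
    also have "\<dots> \<le> ?\<tau> * N powr (-1/2)"
      using N1 by (intro mult_left_mono powr_mono) auto
    finally show "?\<tau> / q ^ (7 * M) \<le> ?\<tau> * N powr (-1/2)" .
  qed
  also have "\<dots> = N powr (- real (Suc k) / 2)"
  proof -
    have "- real k / 2 + -1/2 = - real (Suc k) / 2" by simp
    then show ?thesis by (simp only: powr_add[symmetric])
  qed
  also have "M + 7 * M = 8 ^ Suc k" by (simp add: M_def)
  finally show ?case .
qed

section \<open>Finite differences of convex functions\<close>

lemma within_MVT:
  fixes g g' :: "real \<Rightarrow> real"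
  assumes J: "is_interval J" "x \<in> J" "y \<in> J" "x < y"
    and g: "\<And>z. z \<in> J \<Longrightarrow> (g has_real_derivative g' z) (at z within J)"
  obtains z where "x < z" "z < y" "z \<in> J" "g y - g x = g' z * (y - x)"
proof -
  have sub: "{x..y} \<subseteq> J" by (auto intro: mem_is_interval_1_I[OF J(1,2,3)])
  have "\<exists>z\<in>{x<..<y}. g y - g x = (*) (g' z) (y - x)"
  proof (rule mvt_simple[OF J(4)])
    fix z assume "x \<le> z" "z \<le> y"
    then have "z \<in> J" using sub by auto
    from g[OF this] show "(g has_derivative (*) (g' z)) (at z within {x..y})"
      unfolding has_field_derivative_def by (rule has_derivative_subset[OF _ sub])
  qed
  then obtain z where "z \<in> {x<..<y}" "g y - g x = g' z * (y - x)" by blast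
  then show ?thesis using sub by (intro that[of z]) auto
qed

lemma strictly_monotone_if_derivative:
  fixes g g' :: "real \<Rightarrow> real"
  assumes J: "is_interval J" and g: "\<And>z. z \<in> J \<Longrightarrow> (g has_real_derivative g' z) (at z within J)"
  shows "(\<And>z. z \<in> J \<Longrightarrow> g' z > 0) \<Longrightarrow> strict_mono_on J g"
    and "(\<And>z. z \<in> J \<Longrightarrow> g' z < 0) \<Longrightarrow> strict_antimono_on J g"
proof -
  assume pos: "\<And>z. z \<in> J \<Longrightarrow> g' z > 0"
  show "strict_mono_on J g"
  proof (rule strict_mono_onI)
    fix x y assume xy: "x \<in> J" "y \<in> J" "x < y"
    then obtain z where "z \<in> J" "g y - g x = g' z * (y - x)" using within_MVT[OF J _ _ _ g] by metis
    then show "g x < g y" using pos xy by (metis diff_gt_0_iff_gt mult_pos_pos)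
  qed
next
  assume neg: "\<And>z. z \<in> J \<Longrightarrow> g' z < 0"
  show "strict_antimono_on J g"
  proof (rule monotone_onI)
    fix x y assume xy: "x \<in> J" "y \<in> J" "x < y"
    then obtain z where "z \<in> J" "g y - g x = g' z * (y - x)" using within_MVT[OF J _ _ _ g] by metis
    then show "g x > g y" using neg xy by (metis diff_gt_0_iff_gt diff_less_0_iff_less mult_neg_pos)
  qed
qed

text \<open>\<open>S\<close> is cut at the sign change of \<open>g'\<close>. The mean value point
  lies strictly between \<open>x\<close> and \<open>y\<close>, so \<open>g'\<close> has a strict
  sign there even if it vanishes at \<open>x\<close> or \<open>y\<close>.\<close>

lemma two_monotone_pieces:
  fixes g g' :: "real \<Rightarrow> real"
  assumes J: "is_interval J" "S \<subseteq> J" and g: "\<And>z. z \<in> J \<Longrightarrow> (g has_real_derivative g' z) (at z within J)"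
    and g': "strictly_monotone J g'"
  shows "\<exists>S1 S2. S = S1 \<union> S2 \<and> strictly_monotone S1 g \<and> strictly_monotone S2 g"
  using g'
proof
  assume m: "strict_mono_on J g'"
  have "strict_antimono_on {x\<in>S. g' x \<le> 0} g"
  proof (rule monotone_onI)
    fix x y assume xy: "x \<in> {x\<in>S. g' x \<le> 0}" "y \<in> {x\<in>S. g' x \<le> 0}" "x < y"
    then obtain z where z: "x < z" "z < y" "z \<in> J" "g y - g x = g' z * (y - x)"
      using within_MVT[OF J(1) _ _ _ g, of x y] J(2) by blast
    then have "g' z < g' y" using m J(2) xy by (auto simp: strict_mono_on_def)
    then have "g' z * (y - x) < 0" using xy by (intro mult_neg_pos) auto
    then show "g x > g y" using z by simp
  qed
  moreover have "strict_mono_on {x\<in>S. g' x > 0} g"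
  proof (rule strict_mono_onI)
    fix x y assume xy: "x \<in> {x\<in>S. g' x > 0}" "y \<in> {x\<in>S. g' x > 0}" "x < y"
    then obtain z where z: "x < z" "z < y" "z \<in> J" "g y - g x = g' z * (y - x)"
      using within_MVT[OF J(1) _ _ _ g, of x y] J(2) by blast
    then have "g' x < g' z" using m J(2) xy by (auto simp: strict_mono_on_def)
    then have "g' z * (y - x) > 0" using xy by (intro mult_pos_pos) auto
    then show "g x < g y" using z by simp
  qed
  moreover have "S = {x\<in>S. g' x \<le> 0} \<union> {x\<in>S. g' x > 0}" by auto
  ultimately show ?thesis by blast
next
  assume m: "strict_antimono_on J g'"
  have "strict_mono_on {x\<in>S. g' x \<ge> 0} g"
  proof (rule strict_mono_onI)
    fix x y assume xy: "x \<in> {x\<in>S. g' x \<ge> 0}" "y \<in> {x\<in>S. g' x \<ge> 0}" "x < y"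
    then obtain z where z: "x < z" "z < y" "z \<in> J" "g y - g x = g' z * (y - x)"
      using within_MVT[OF J(1) _ _ _ g, of x y] J(2) by blast
    then have "g' z > g' y" using m J(2) xy by (auto simp: monotone_on_def)
    then have "g' z * (y - x) > 0" using xy by (intro mult_pos_pos) auto
    then show "g x < g y" using z by simp
  qed
  moreover have "strict_antimono_on {x\<in>S. g' x < 0} g"
  proof (rule monotone_onI)
    fix x y assume xy: "x \<in> {x\<in>S. g' x < 0}" "y \<in> {x\<in>S. g' x < 0}" "x < y"
    then obtain z where z: "x < z" "z < y" "z \<in> J" "g y - g x = g' z * (y - x)"
      using within_MVT[OF J(1) _ _ _ g, of x y] J(2) by blast
    then have "g' x > g' z" using m J(2) xy by (auto simp: monotone_on_def)
    then have "g' z * (y - x) < 0" using xy by (intro mult_neg_pos) auto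
    then show "g x > g y" using z by simp
  qed
  moreover have "S = {x\<in>S. g' x \<ge> 0} \<union> {x\<in>S. g' x < 0}" by auto
  ultimately show ?thesis by blast
qed

lemma fd_convex_cong:
  "(\<And>x. x \<in> S \<Longrightarrow> f x = h x) \<Longrightarrow> fd_convex k S f = fd_convex k S h"
proof (induction k arbitrary: S f h)
  case (Suc k)
  have "(S = S1 \<union> S2 \<and> strictly_monotone S1 f \<and> strictly_monotone S2 f) \<longleftrightarrow>
     (S = S1 \<union> S2 \<and> strictly_monotone S1 h \<and> strictly_monotone S2 h)" for S1 S2
    using Suc.prems by (auto simp: monotone_on_def)
  moreover have "fd_convex k (shift_dom d S) (fdiff d f) = fd_convex k (shift_dom d S) (fdiff d h)" for d
    by (rule Suc.IH) (use Suc.prems in \<open>auto simp: shift_dom_def fdiff_def\<close>)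
  ultimately show ?case by simp
qed simp

text \<open>On the part of \<open>J\<close> where \<open>x + d\<close> stays in \<open>J\<close>,
  the derivatives of the difference function are the differences of the \<open>g j\<close>. Strict
  monotonicity of \<open>g (Suc j)\<close> gives its difference a fixed sign, so the difference of
  \<open>g j\<close> is strictly monotone, at the cost of one order.\<close>

lemma fd_convex_if_derivatives:
  fixes g :: "nat \<Rightarrow> real \<Rightarrow> real"
  assumes "is_interval J" "S \<subseteq> J"
    and "\<And>j x. j < k \<Longrightarrow> x \<in> J \<Longrightarrow> (g j has_real_derivative g (Suc j) x) (at x within J)"
    and "\<And>j. j \<in> {1..k} \<Longrightarrow> strictly_monotone J (g j)"
  shows "fd_convex k S (g 0)"
  using assms
proof (induction k arbitrary: S J g)
  case (Suc k)
  note der = Suc.prems(3) and mon = Suc.prems(4)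
  have pieces: "\<exists>S1 S2. S = S1 \<union> S2 \<and> strictly_monotone S1 (g 0) \<and> strictly_monotone S2 (g 0)"
    by (rule two_monotone_pieces[OF Suc.prems(1,2), of _ "g 1"]) (use der[of 0] mon[of 1] in auto)
  have "fd_convex k (shift_dom d S) (fdiff d (g 0))" if d: "d > 0" for d
  proof -
    define J' where "J' = {x\<in>J. x + d \<in> J}"
    define h where "h = (\<lambda>j. fdiff d (g j))"
    have J': "is_interval J'"
      unfolding J'_def is_interval_1
    proof (intro ballI allI impI CollectI conjI; elim conjE CollectE)
      fix a b x assume ab: "a \<in> J" "a + d \<in> J" "b \<in> J" "b + d \<in> J" "a \<le> x" "x \<le> b"
      show "x \<in> J" by (rule mem_is_interval_1_I[OF Suc.prems(1) ab(1,3)]) (use ab in auto)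
      show "x + d \<in> J" by (rule mem_is_interval_1_I[OF Suc.prems(1) ab(2,4)]) (use ab in auto)
    qed
    have derh: "(h j has_real_derivative h (Suc j) x) (at x within J')" if "j < Suc k" "x \<in> J'" for j x
    proof -
      have x: "x \<in> J" "x + d \<in> J" using that by (auto simp: J'_def)
      have 1: "(g j has_real_derivative g (Suc j) x) (at x within J')"
        by (rule DERIV_subset[OF der[OF that(1) x(1)]]) (auto simp: J'_def)
      have "(g j has_real_derivative g (Suc j) (x + d)) (at (x + d) within (\<lambda>x. x + d) ` J')"
        by (rule DERIV_subset[OF der[OF that(1) x(2)]]) (auto simp: J'_def)
      moreover have "((\<lambda>x. x + d) has_real_derivative 1) (at x within J')"
        by (auto intro!: derivative_eq_intros)
      ultimately have "(g j \<circ> (\<lambda>x. x + d) has_real_derivative g (Suc j) (x + d) * 1) (at x within J')"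
        by (rule DERIV_image_chain)
      from DERIV_diff[OF this 1] show ?thesis by (simp add: h_def fdiff_def[abs_def] comp_def)
    qed
    have "strictly_monotone J' (h j)" if j: "j \<in> {1..k}" for j
    proof -
      have dj: "\<And>x. x \<in> J' \<Longrightarrow> (h j has_real_derivative h (Suc j) x) (at x within J')"
        using derh j by auto
      have "strictly_monotone J (g (Suc j))" using mon j by auto
      then show ?thesis
      proof
        assume "strict_mono_on J (g (Suc j))"
        then have "h (Suc j) x > 0" if "x \<in> J'" for x
          using that d by (auto simp: J'_def h_def fdiff_def strict_mono_on_def)
        then show ?thesis using strictly_monotone_if_derivative(1)[OF J' dj] by blast
      next
        assume "strict_antimono_on J (g (Suc j))"
        then have "h (Suc j) x < 0" if "x \<in> J'" for x
          using that d by (auto simp: J'_def h_def fdiff_def monotone_on_def)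
        then show ?thesis using strictly_monotone_if_derivative(2)[OF J' dj] by blast
      qed
    qed
    moreover have "shift_dom d S \<subseteq> J'" using Suc.prems(2) by (auto simp: shift_dom_def J'_def)
    ultimately have "fd_convex k (shift_dom d S) (h 0)"
      using J' derh by (intro Suc.IH[of J']) auto
    then show ?thesis by (simp add: h_def)
  qed
  with pieces show ?case by simp
qed simp

lemma k_convex_on_imp_fd_convex:
  assumes "k_convex_on k I f" "k' \<le> k"
  shows "fd_convex k' I f"
proof -
  obtain J g where J: "is_interval J" "I \<subseteq> J" "\<forall>x\<in>J. g 0 x = f x"
    "\<forall>j<k. \<forall>x\<in>J. (g j has_real_derivative g (Suc j) x) (at x within J)"
    "\<forall>j\<in>{1..k}. strictly_monotone J (g j)"
    using assms(1) unfolding k_convex_on_def by blast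
  have "fd_convex k' I (g 0)"
    by (rule fd_convex_if_derivatives[OF J(1,2)]) (use J assms(2) in auto)
  also have "fd_convex k' I (g 0) = fd_convex k' I f"
    by (rule fd_convex_cong) (use J in auto)
  finally show ?thesis .
qed

section \<open>Sets with few points\<close>

lemma sum_square_diff_translates:
  fixes v :: "'a \<Rightarrow> real" and a b :: real
  assumes "finite W" "finite Z" "(\<lambda>p. v p + a) ` W \<subseteq> Z" "(\<lambda>p. v p + b) ` W \<subseteq> Z"
  shows "(\<Sum>z\<in>Z. (real (card {p\<in>W. v p + a = z}) - real (card {p\<in>W. v p + b = z}))\<^sup>2)
    = 2 * (real (self_coll W v) - real (coll W v W (\<lambda>p. v p + (b - a))))"
proof -
  let ?a = "\<lambda>z. card {p\<in>W. v p + a = z}" and ?b = "\<lambda>z. card {p\<in>W. v p + b = z}"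
  have e: "self_coll W (\<lambda>p. v p + c) = self_coll W v" for c by (simp add: coll_def)
  have c: "coll W (\<lambda>p. v p + a) W (\<lambda>p. v p + b) = coll W v W (\<lambda>p. v p + (b - a))"
    unfolding coll_def by (rule arg_cong[where f = card]) auto
  have "(\<Sum>z\<in>Z. ?a z * ?a z) = self_coll W v" "(\<Sum>z\<in>Z. ?b z * ?b z) = self_coll W v"
    "(\<Sum>z\<in>Z. ?a z * ?b z) = coll W v W (\<lambda>p. v p + (b - a))"
    using coll_eq_sum[OF assms(1,1,2,3), of "\<lambda>p. v p + a"] coll_eq_sum[OF assms(1,1,2,3), of "\<lambda>p. v p + b"]
      coll_eq_sum[OF assms(1,1,2,4), of "\<lambda>p. v p + b"] by (simp_all add: e c)
  then have s: "(\<Sum>z\<in>Z. real (?a z) * real (?a z)) = real (self_coll W v)"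
    "(\<Sum>z\<in>Z. real (?b z) * real (?b z)) = real (self_coll W v)"
    "(\<Sum>z\<in>Z. real (?a z) * real (?b z)) = real (coll W v W (\<lambda>p. v p + (b - a)))"
    by (simp_all flip: of_nat_mult of_nat_sum)
  have "(\<Sum>z\<in>Z. (real (?a z) - real (?b z))\<^sup>2)
    = (\<Sum>z\<in>Z. real (?a z) * real (?a z)) + (\<Sum>z\<in>Z. real (?b z) * real (?b z))
      - 2 * (\<Sum>z\<in>Z. real (?a z) * real (?b z))"
  proof -
    have "(x - y)\<^sup>2 = x * x + y * y - 2 * (x * y)" for x y :: real
      by (simp add: power2_eq_square algebra_simps)
    then show ?thesis by (simp only: sum.distrib sum_subtractf sum_distrib_left)
  qed
  then show ?thesis by (simp add: s)
qed

text \<open>With \<open>\<beta>\<close> the counting function of \<open>v\<close>, the defect at \<open>y\<close> is half of \<open>\<parallel>\<beta> - \<beta>(\<cdot> - y)\<parallel>\<^sup>2\<close>, so its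
  square root is subadditive in \<open>y\<close>.\<close>

lemma translate_defect:
  fixes v :: "'a \<Rightarrow> real" and d :: real
  assumes fin: "finite W"
  shows "real (self_coll W v) - real (coll W v W (\<lambda>p. v p + real j * d))
    \<le> (real j)\<^sup>2 * (real (self_coll W v) - real (coll W v W (\<lambda>p. v p + d)))"
proof -
  define Z where "Z = (\<Union>i\<in>{..j}. (\<lambda>p. v p + real i * d) ` W)"
  have finZ: "finite Z" using fin by (simp add: Z_def)
  have sub: "(\<lambda>p. v p + real i * d) ` W \<subseteq> Z" if "i \<le> j" for i using that by (auto simp: Z_def)
  define \<beta> where "\<beta> = (\<lambda>i z. real (card {p\<in>W. v p + real i * d = z}))"
  have "2 * (real (self_coll W v) - real (coll W v W (\<lambda>p. v p + real j * d))) = (\<Sum>z\<in>Z. (\<beta> 0 z - \<beta> j z)\<^sup>2)"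
    using sum_square_diff_translates[OF fin finZ sub[of 0] sub[of j]] by (simp add: \<beta>_def)
  also have "\<dots> \<le> (\<Sum>z\<in>Z. real j * (\<Sum>i<j. (\<beta> i z - \<beta> (Suc i) z)\<^sup>2))"
  proof (rule sum_mono)
    fix z
    have "\<beta> 0 z - \<beta> j z = (\<Sum>i<j. \<beta> i z - \<beta> (Suc i) z)"
      using sum_lessThan_telescope'[of "\<lambda>i. \<beta> i z" j] by simp
    then show "(\<beta> 0 z - \<beta> j z)\<^sup>2 \<le> real j * (\<Sum>i<j. (\<beta> i z - \<beta> (Suc i) z)\<^sup>2)"
      using sum_squared_le_sum_of_squares[of "\<lambda>i. \<beta> i z - \<beta> (Suc i) z" "{..<j}"]
      by (simp add: mult.commute)
  qed
  also have "\<dots> = real j * (\<Sum>i<j. \<Sum>z\<in>Z. (\<beta> i z - \<beta> (Suc i) z)\<^sup>2)"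
    by (subst sum.swap) (simp add: sum_distrib_left)
  also have "\<dots> = real j * (\<Sum>i<j. 2 * (real (self_coll W v) - real (coll W v W (\<lambda>p. v p + d))))"
  proof (intro arg_cong2[where f = "(*)"] sum.cong refl)
    fix i assume "i \<in> {..<j}"
    then have "i \<le> j" "Suc i \<le> j" by auto
    have "real (Suc i) * d - real i * d = d" by (simp add: algebra_simps)
    with sum_square_diff_translates[OF fin finZ sub[OF \<open>i \<le> j\<close>] sub[OF \<open>Suc i \<le> j\<close>]]
    show "(\<Sum>z\<in>Z. (\<beta> i z - \<beta> (Suc i) z)\<^sup>2) = 2 * (real (self_coll W v) - real (coll W v W (\<lambda>p. v p + d)))"
      unfolding \<beta>_def by simp
  qed
  also have "\<dots> = 2 * ((real j)\<^sup>2 * (real (self_coll W v) - real (coll W v W (\<lambda>p. v p + d))))"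
    by (simp add: power2_eq_square)
  finally show ?thesis by simp
qed

text \<open>As \<open>d \<noteq> 0\<close>, a pair \<open>(p, q)\<close> determines
  \<open>j\<close>, so the sets counted are disjoint parts of \<open>W \<times> W\<close>.\<close>

lemma sum_coll_multiples_le:
  fixes v :: "'a \<Rightarrow> real" and d :: real
  assumes fin: "finite W" and d: "d \<noteq> 0"
  shows "(\<Sum>j\<in>{1..J}. coll W v W (\<lambda>p. v p + real j * d)) \<le> (card W)\<^sup>2"
proof -
  let ?A = "\<lambda>j. {(p, q). p \<in> W \<and> q \<in> W \<and> v p = v q + real j * d}"
  have "(\<Sum>j\<in>{1..J}. coll W v W (\<lambda>p. v p + real j * d)) = card (\<Union>j\<in>{1..J}. ?A j)"
    unfolding coll_def
  proof (rule card_UN_disjoint[symmetric])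
    show "\<forall>j\<in>{1..J}. finite (?A j)" using fin by (intro ballI finite_coll_set) auto
  qed (use d in auto)
  also have "\<dots> \<le> card (W \<times> W)" by (rule card_mono) (use fin in auto)
  finally show ?thesis by (simp add: card_cartesian_product power2_eq_square)
qed

text \<open>The energy of order \<open>m + 1\<close> is at most a sum of autocorrelations, each at
  most \<open>\<rho> 0\<close>. Near equality forces \<open>\<rho> d\<close> close to
  \<open>\<rho> 0\<close> for the one difference \<open>d = f a' - f a\<close>, hence
  \<open>\<rho> (j * d) \<ge> \<rho> 0 / 2\<close> for all \<open>j \<le> J\<close>; but the sum of
  these is at most the number of all pairs.\<close>

lemma energy_small_if_stationary:
  fixes f :: "'a \<Rightarrow> real"
  assumes fin: "finite S" and a: "a \<in> S" "a' \<in> S" "f a \<noteq> f a'"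
    and \<delta>: "(real J)\<^sup>2 * (\<delta> * (real (card S))\<^sup>2) \<le> 1/2"
    and stat: "(1 - \<delta>) * (real (card S))\<^sup>2 * real (energy m S f) \<le> real (energy (Suc m) S f)"
  shows "real J * real (energy m S f) \<le> 2 * real (card S) ^ (2 * m)"
proof -
  define W where "W = tup m S"
  define v where "v = (\<lambda>p. sumf f p)"
  have finW: "finite W" using fin by (simp add: W_def)
  have e: "self_coll W v = energy m S f" by (simp add: W_def v_def energy_def)
  define d where "d = f a' - f a"
  define \<rho> where "\<rho> = (\<lambda>y. real (coll W v W (\<lambda>p. v p + y)))"
  have \<rho>0: "\<rho> 0 = real (energy m S f)" by (simp add: \<rho>_def e)
  have \<rho>: "real (coll W (\<lambda>p. v p + x) W (\<lambda>p. v p + y)) = \<rho> (y - x)" for x y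
    unfolding \<rho>_def coll_def by (rule arg_cong[where f = "\<lambda>A. real (card A)"]) auto
  have \<rho>le: "\<rho> y \<le> \<rho> 0" for y
    using coll_translate_le[OF finW, of v 0 y] by (simp add: \<rho>_def)
  have finSS: "finite (S \<times> S)" using fin by simp
  have "real (energy (Suc m) S f) \<le> (\<Sum>(i, i')\<in>S \<times> S. \<rho> (f i' - f i))"
    using of_nat_mono[OF energy_Suc_le_sum[OF fin, of m f], where 'a = real]
    by (simp add: case_prod_unfold \<rho>[symmetric] W_def v_def)
  also have "\<dots> = \<rho> d + (\<Sum>(i, i')\<in>S \<times> S - {(a, a')}. \<rho> (f i' - f i))"
    using a by (subst sum.remove[OF finSS, of "(a, a')"]) (auto simp: d_def)
  also have "\<dots> \<le> \<rho> d + (\<Sum>(i, i')\<in>S \<times> S - {(a, a')}. \<rho> 0)"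
    by (intro add_left_mono sum_mono) (use \<rho>le in auto)
  also have "(\<Sum>(i, i')\<in>S \<times> S - {(a, a')}. \<rho> 0) = ((real (card S))\<^sup>2 - 1) * \<rho> 0"
  proof -
    have "card (S \<times> S) > 0" using a fin by (auto simp: card_gt_0_iff)
    then have "real (card (S \<times> S - {(a, a')})) = real (card (S \<times> S)) - 1"
      using a fin by (subst card_Diff_singleton) (auto simp: of_nat_diff)
    then show ?thesis by (simp add: case_prod_unfold card_cartesian_product power2_eq_square)
  qed
  \<comment> \<open>All other pairs are bounded trivially, so the whole deficit is charged to the
    single pair \<open>(a, a')\<close>; hence the factor \<open>(card S)\<^sup>2\<close> in
    \<open>defect\<close>.\<close>
  finally have "(1 - \<delta>) * (real (card S))\<^sup>2 * \<rho> 0 \<le> \<rho> d + ((real (card S))\<^sup>2 - 1) * \<rho> 0"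
    using stat \<rho>0 by simp
  then have defect: "\<rho> 0 - \<rho> d \<le> \<delta> * (real (card S))\<^sup>2 * \<rho> 0" by (simp add: algebra_simps)
  have half: "\<rho> 0 / 2 \<le> \<rho> (real j * d)" if "j \<in> {1..J}" for j
  proof -
    have "\<rho> 0 - \<rho> (real j * d) \<le> (real j)\<^sup>2 * (\<rho> 0 - \<rho> d)"
      using translate_defect[OF finW, of v j d] by (simp add: \<rho>_def)
    also have "\<dots> \<le> (real J)\<^sup>2 * (\<delta> * (real (card S))\<^sup>2 * \<rho> 0)"
      using that defect \<rho>le[of d] by (intro mult_mono power_mono) auto
    also have "\<dots> = ((real J)\<^sup>2 * (\<delta> * (real (card S))\<^sup>2)) * \<rho> 0" by simp
    also have "\<dots> \<le> 1/2 * \<rho> 0" using \<delta> by (intro mult_right_mono) (auto simp: \<rho>0)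
    finally show ?thesis by simp
  qed
  have "real J * (\<rho> 0 / 2) = (\<Sum>j\<in>{1..J}. \<rho> 0 / 2)" by simp
  also have "\<dots> \<le> (\<Sum>j\<in>{1..J}. \<rho> (real j * d))" by (rule sum_mono) (rule half)
  also have "\<dots> \<le> real ((card W)\<^sup>2)"
    using of_nat_mono[OF sum_coll_multiples_le[OF finW, of d v J], where 'a = real] a
    by (simp add: \<rho>_def d_def)
  also have "\<dots> = real (card S) ^ (2 * m)"
    using fin by (simp add: W_def card_tup power_mult[symmetric] mult.commute)
  finally show ?thesis by (simp add: \<rho>0)
qed

text \<open>Either some step below \<open>M\<close> is almost stationary, which gives
  \<open>2 / J\<close>, or every step loses a factor \<open>1 - \<delta>\<close>. In the latter case
  \<open>1 - \<delta> \<le> 1 / (1 + \<delta>)\<close> and Bernoulli's inequality give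
  \<open>1 / (M * \<delta>)\<close>.\<close>

lemma energy_le_of_few_points:
  fixes f :: "'a \<Rightarrow> real"
  assumes fin: "finite S" and a: "a \<in> S" "a' \<in> S" "f a \<noteq> f a'" and J: "J > 0" and M: "M > 0"
  shows "real (energy M S f) / real (card S) ^ (2 * M)
    \<le> max (2 * (real J)\<^sup>2 * (real (card S))\<^sup>2 / real M) (2 / real J)"
proof -
  define N where "N = real (card S)"
  have N: "N > 0" using a fin by (auto simp: N_def card_gt_0_iff)
  define \<delta> where "\<delta> = 1 / (2 * (real J)\<^sup>2 * N\<^sup>2)"
  have \<delta>0: "\<delta> > 0" unfolding \<delta>_def using J N by simp
  have N1: "N \<ge> 1" using N by (simp add: N_def)
  have \<delta>1: "\<delta> \<le> 1"
  proof -
    have "1 \<le> (real J)\<^sup>2" "1 \<le> N\<^sup>2" using J N1 by (auto simp: one_le_power)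
    then have "1 * 1 \<le> (real J)\<^sup>2 * N\<^sup>2" by (intro mult_mono) auto
    then have "1 \<le> 2 * (real J)\<^sup>2 * N\<^sup>2" by simp
    then show ?thesis unfolding \<delta>_def by (subst divide_le_eq_1_pos) linarith+
  qed
  define t where "t = (\<lambda>m. real (energy m S f) / N ^ (2 * m))"
  show ?thesis
  proof (cases "\<exists>m<M. (1 - \<delta>) * t m \<le> t (Suc m)")
    case True
    then obtain m where m: "m < M" "(1 - \<delta>) * t m \<le> t (Suc m)" by blast
    have "real J * real (energy m S f) \<le> 2 * real (card S) ^ (2 * m)"
    proof (rule energy_small_if_stationary[OF fin a])
      show "(real J)\<^sup>2 * (\<delta> * (real (card S))\<^sup>2) \<le> 1/2"
        unfolding \<delta>_def N_def[symmetric] using J N by simp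
      show "(1 - \<delta>) * (real (card S))\<^sup>2 * real (energy m S f) \<le> real (energy (Suc m) S f)"
      proof -
        have "(1 - \<delta>) * t m * (N ^ (2 * m) * N\<^sup>2) \<le> t (Suc m) * (N ^ (2 * m) * N\<^sup>2)"
          using m(2) N by (intro mult_right_mono) auto
        then show ?thesis
          using N unfolding t_def N_def[symmetric] by (simp add: power2_eq_square mult_ac)
      qed
    qed
    then have "t m \<le> 2 / real J" using J N unfolding t_def N_def[symmetric] by (simp add: field_simps)
    moreover have "t M \<le> t m" unfolding t_def N_def by (rule energy_antimono[OF fin]) (use m in auto)
    ultimately show ?thesis unfolding t_def N_def by simp
  next
    case False
    have "t m \<le> (1 - \<delta>) ^ m" if "m \<le> M" for m
      using that
    proof (induction m)
      case 0
      then show ?case by (simp add: t_def energy_0)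
    next
      case (Suc m)
      then have "t (Suc m) \<le> (1 - \<delta>) * t m" using False by (meson Suc_le_lessD linear)
      also have "\<dots> \<le> (1 - \<delta>) * (1 - \<delta>) ^ m" using Suc \<delta>1 by (intro mult_left_mono) auto
      finally show ?case by simp
    qed
    then have "t M \<le> (1 - \<delta>) ^ M" by simp
    also have "\<dots> \<le> 1 / (1 + \<delta>) ^ M"
    proof -
      have "(1 - \<delta>) * (1 + \<delta>) \<le> 1" by (simp add: algebra_simps)
      then have "((1 - \<delta>) * (1 + \<delta>)) ^ M \<le> 1" using \<delta>0 \<delta>1 by (intro power_le_one) auto
      then have "(1 - \<delta>) ^ M * (1 + \<delta>) ^ M \<le> 1" by (simp only: power_mult_distrib)
      then show ?thesis using \<delta>0 by (simp add: pos_le_divide_eq)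
    qed
    also have "\<dots> \<le> 1 / (real M * \<delta>)"
    proof -
      have "real M * \<delta> \<le> (1 + \<delta>) ^ M" using Bernoulli_inequality[of \<delta> M] \<delta>0 by simp
      then show ?thesis using \<delta>0 M by (intro divide_left_mono) auto
    qed
    also have "\<dots> = 2 * (real J)\<^sup>2 * N\<^sup>2 / real M" by (simp add: \<delta>_def)
    finally show ?thesis unfolding t_def N_def by simp
  qed
qed

section \<open>Choice of parameters\<close>

lemma energy_1_le: "finite S \<Longrightarrow> energy 1 S (\<lambda>x. x) \<le> card S"
  unfolding energy_def coll_def
  by (rule card_inj_on_le[where f = "\<lambda>(xs, ys). hd xs"]) (auto simp: inj_on_def tup_def length_Suc_conv)

lemma energy_le_card_power: "finite S \<Longrightarrow> real (energy m S f) \<le> real (card S) ^ (2 * m)"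
proof (induction m)
  case (Suc m)
  have "real (energy (Suc m) S f) \<le> (real (card S))\<^sup>2 * real (energy m S f)"
    using of_nat_mono[OF energy_Suc_le[OF Suc.prems, of m f], where 'a = real] by simp
  also have "\<dots> \<le> (real (card S))\<^sup>2 * real (card S) ^ (2 * m)" using Suc by (intro mult_left_mono) auto
  finally show ?case by (simp add: power2_eq_square)
qed (simp add: energy_0)

lemma two_powr_ge: "y / 2 \<le> 2 powr (y::real)"
proof (cases "y \<ge> 0")
  case True
  have "y * (1/2) \<le> y * ln 2" using True ln2_ge_two_thirds by (intro mult_left_mono) auto
  then have "y / 2 \<le> y * ln 2" by simp
  also have "\<dots> \<le> exp (y * ln 2)" using exp_ge_add_one_self[of "y * ln 2"] by linarith
  finally show ?thesis by (simp add: powr_def)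
next
  case False
  then have "y / 2 \<le> 0" by simp
  also have "0 \<le> 2 powr y" by simp
  finally show ?thesis .
qed

text \<open>In the application \<open>\<theta> = log 2 l\<close> and \<open>u\<close> is the fourth
  root of \<open>l\<close>, so the case is \<open>log 2 N \<le> sqrt l\<close>. The target is only
  \<open>2 powr (- (log 2 N * \<theta>) / 100)\<close>, where
  \<open>log 2 N * \<theta> \<le> l\<close>, so a bound exponentially small in \<open>l\<close>
  suffices.\<close>

lemma few_points_case:
  fixes A :: "real set" and N \<theta> u :: real
  assumes A: "finite A" "card A \<ge> 2" "real (card A) \<le> N"
    and u: "real l = u ^ 4" "u \<ge> 1000" "\<theta> \<le> 8 * u" "\<theta> \<ge> 0" and n: "log 2 N \<le> u\<^sup>2"
  shows "real (energy (2 ^ l) A (\<lambda>x. x)) / N ^ (2 * 2 ^ l) \<le> N powr (- \<theta> / 100)"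
proof -
  define n where "n = log 2 N"
  have N: "N \<ge> 2" using A by linarith
  have Nn: "N = 2 powr n" unfolding n_def using N by simp
  have n1: "n \<ge> 1" unfolding n_def using N by (simp add: le_log_iff)
  obtain a a' where a: "a \<in> A" "a' \<in> A" "a \<noteq> a'"
    using A(2) by (metis card_2_iff' obtain_subset_with_card_n subset_iff)
  \<comment> \<open>With \<open>J\<close> about \<open>2 powr (l / 4)\<close> the two bounds are
    about \<open>N\<^sup>2 * 2 powr (- l / 2)\<close> and \<open>2 powr (- l / 4)\<close>; both are
    below \<open>2 powr (- l / 8)\<close>.\<close>
  define J :: nat where "J = 2 ^ (l div 4)"
  have uu: "u\<^sup>2 \<ge> 1000 * u" "u ^ 4 = u\<^sup>2 * u\<^sup>2"
    using u(2) by (auto simp: power2_eq_square power4_eq_xxxx)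
  have u2: "u\<^sup>2 \<ge> 1000" using uu(1) u(2) by linarith
  have l: "real l \<ge> 1000 * u\<^sup>2"
    unfolding u(1) uu(2) using u2 by (intro mult_right_mono) auto
  have Jr: "real J = 2 powr (real (l div 4))" by (simp add: J_def powr_realpow)
  have div: "real (l div 4) \<le> real l / 4" "real (l div 4) \<ge> real l / 4 - 1" by linarith+
  have "real (energy (2 ^ l) A (\<lambda>x. x)) / N ^ (2 * 2 ^ l) \<le> real (energy (2 ^ l) A (\<lambda>x. x)) / real (card A) ^ (2 * 2 ^ l)"
    using A by (intro divide_left_mono power_mono mult_pos_pos) auto
  also have "\<dots> \<le> max (2 * (real J)\<^sup>2 * (real (card A))\<^sup>2 / real (2 ^ l)) (2 / real J)"
    by (rule energy_le_of_few_points[OF A(1) a(1,2)]) (use a in \<open>auto simp: J_def\<close>)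
  also have "\<dots> \<le> 2 powr (- real l / 8)"
  proof (rule max.boundedI)
    have pow: "real (2 ^ l) = 2 powr l" by (simp add: powr_realpow)
    have "2 * (real J)\<^sup>2 * (real (card A))\<^sup>2 / real (2 ^ l) \<le> 2 * (real J)\<^sup>2 * N\<^sup>2 / 2 powr l"
      unfolding pow using A by (intro divide_right_mono mult_left_mono power_mono) auto
    also have "\<dots> = 2 powr (1 + (real (l div 4) + real (l div 4)) + (n + n) - l)"
      unfolding Jr Nn power2_eq_square powr_add powr_diff by simp
    also have "\<dots> \<le> 2 powr (- real l / 8)"
      using div l u2 n unfolding n_def[symmetric] by (intro powr_mono) linarith+
    finally show "2 * (real J)\<^sup>2 * (real (card A))\<^sup>2 / real (2 ^ l) \<le> 2 powr (- real l / 8)" .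
    have "2 / real J = 2 powr (1 - real (l div 4))" by (simp add: Jr powr_diff)
    also have "\<dots> \<le> 2 powr (- real l / 8)"
      using div l u2 by (intro powr_mono) linarith+
    finally show "2 / real J \<le> 2 powr (- real l / 8)" .
  qed
  also have "\<dots> \<le> 2 powr (n * (- \<theta> / 100))"
  proof (rule powr_mono)
    have "n * \<theta> \<le> u\<^sup>2 * u\<^sup>2"
    proof (rule mult_mono)
      show "n \<le> u\<^sup>2" using n by (simp add: n_def)
      show "\<theta> \<le> u\<^sup>2" using uu(1) u(2,3) by linarith
    qed (use u in auto)
    then have "n * \<theta> \<le> real l" unfolding u(1) uu(2) .
    moreover have "n * (- \<theta> / 100) = - (n * \<theta>) / 100" by simp
    ultimately show "- real l / 8 \<le> n * (- \<theta> / 100)" by linarith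
  qed simp
  also have "\<dots> = N powr (- \<theta> / 100)" unfolding Nn by (simp add: powr_powr)
  finally show ?thesis .
qed

lemma many_points_case:
  fixes I :: "real set" and N \<theta> u \<epsilon> :: real
  assumes I: "finite I" "N = real (card I)" "N > 0" and f: "k_convex_on k I f" "\<theta> \<le> real k"
    and \<epsilon>: "\<epsilon> \<ge> 0" "real (card (sum_diff_set I)) \<le> N powr (1 + \<epsilon>)" "\<epsilon> \<le> \<theta> / real l"
    and u: "real l = u ^ 4" "u = 2 powr (\<theta> / 4)" "u \<ge> 1000" "\<theta> \<le> 8 * u" "\<theta> \<ge> 100" and n: "u\<^sup>2 \<le> log 2 N"
  shows "real (energy (2 ^ l) I f) / N ^ (2 * 2 ^ l) \<le> N powr (- \<theta> / 100)"
proof -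
  define n where "n = log 2 N"
  have Nn: "N = 2 powr n" unfolding n_def using I by simp
  have N1: "N \<ge> 1" using I by simp
  \<comment> \<open>About \<open>\<theta> / 12\<close> orders of convexity are used, so that
    \<open>8 ^ k'\<close> is at most \<open>u\<close>. The saving exponent \<open>k' / 2\<close>
    still exceeds \<open>\<theta> / 100\<close>.\<close>
  define k' where "k' = nat \<lfloor>\<theta> / 12\<rfloor>"
  have k': "real k' \<le> \<theta> / 12" "real k' \<ge> \<theta> / 12 - 1" using u(5) unfolding k'_def by linarith+
  define K where "K = real (card (sum_diff_set I)) / N"
  have K: "real (card (sum_diff_set I)) = K * N" using I(3) by (simp add: K_def)
  have K1: "K \<ge> 1"
  proof -
    have "x \<in> sum_diff_set I" if "x \<in> I" for x unfolding sum_diff_set_def using that by force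
    then have "card I \<le> card (sum_diff_set I)"
      by (intro card_mono finite_sum_diff_set I) auto
    then show ?thesis using I by (simp add: K_def)
  qed
  have KN: "K \<le> 2 powr (\<epsilon> * n)"
  proof -
    have "K \<le> N powr (1 + \<epsilon>) / N" unfolding K_def using \<epsilon>(2) I by (intro divide_right_mono) auto
    also have "\<dots> = N powr \<epsilon>" using I by (simp add: powr_add)
    also have "\<dots> = 2 powr (\<epsilon> * n)" by (simp add: Nn powr_powr mult.commute)
    finally show ?thesis .
  qed
  have eight: "real (8 ^ k') \<le> u"
  proof -
    have "real (8 ^ k') = 2 powr (3 * real k')" by (simp add: powr_realpow[symmetric] powr_powr[symmetric])
    also have "\<dots> \<le> u" unfolding u(2) using k' by (intro powr_mono) auto
    finally show ?thesis .
  qed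
  have uu: "u\<^sup>2 \<ge> 1000 * u" using u(3) by (auto simp: power2_eq_square)
  \<comment> \<open>From \<open>\<epsilon> \<le> \<theta> / l\<close> and
    \<open>\<theta> \<le> 8 * u\<close> one gets \<open>u * \<epsilon> \<le> 8 / u\<^sup>2\<close>.
    In \<open>cond\<close> the power of \<open>K\<close> then takes at most half of the exponent
    \<open>n / 8\<close>, and \<open>n \<ge> u\<^sup>2\<close> absorbs the constants.\<close>
  have \<epsilon>u: "u * \<epsilon> \<le> 1/32"
  proof -
    have l0: "real l > 0" using u(1,3) by simp
    have "\<epsilon> * u ^ 4 \<le> \<theta>" using \<epsilon>(3) l0 by (simp add: field_simps u(1))
    then have "(u * \<epsilon> * u\<^sup>2) * u \<le> 8 * u" using u(4) by (simp add: power2_eq_square power4_eq_xxxx mult_ac)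
    then have "u * \<epsilon> * u\<^sup>2 \<le> 8" by (rule mult_right_le_imp_le) (use u(3) in simp)
    moreover have "u * \<epsilon> * 256 \<le> u * \<epsilon> * u\<^sup>2" using uu u(3) \<epsilon>(1) by (intro mult_left_mono) auto
    ultimately show ?thesis by simp
  qed
  have cond: "26 * (24 * K) ^ (2 * 8 ^ k') \<le> N powr (1/8)"
  proof -
    have n0: "n \<ge> 0" using n uu u(3) unfolding n_def[symmetric] by linarith
    have "24 * K \<le> 2 powr 5 * 2 powr (\<epsilon> * n)" using KN K1 by (intro mult_mono) auto
    also have "\<dots> = 2 powr (5 + \<epsilon> * n)" by (simp add: powr_add)
    finally have "(24 * K) ^ (2 * 8 ^ k') \<le> (2 powr (5 + \<epsilon> * n)) ^ (2 * 8 ^ k')"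
      using K1 by (intro power_mono) auto
    also have "\<dots> = 2 powr ((5 + \<epsilon> * n) * real (2 * 8 ^ k'))"
      by (simp only: powr_realpow[symmetric] powr_gt_zero powr_powr)
    also have "\<dots> \<le> 2 powr ((5 + \<epsilon> * n) * (2 * u))"
      using eight n0 \<epsilon>(1) by (intro powr_mono mult_left_mono) auto
    finally have "26 * (24 * K) ^ (2 * 8 ^ k') \<le> 2 powr 5 * 2 powr ((5 + \<epsilon> * n) * (2 * u))"
      using K1 by (intro mult_mono) auto
    also have "\<dots> = 2 powr (5 + (5 + \<epsilon> * n) * (2 * u))" by (simp add: powr_add)
    also have "\<dots> \<le> 2 powr (n * (1/8))"
    proof (rule powr_mono)
      have "u * \<epsilon> * n \<le> 1/32 * n" using \<epsilon>u n0 by (intro mult_right_mono) auto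
      moreover have "(5 + \<epsilon> * n) * (2 * u) = 10 * u + 2 * (u * \<epsilon> * n)" by (simp add: algebra_simps)
      ultimately show "5 + (5 + \<epsilon> * n) * (2 * u) \<le> n * (1/8)"
        using n uu u(3) unfolding n_def[symmetric] by linarith
    qed simp
    also have "\<dots> = N powr (1/8)" unfolding Nn by (simp add: powr_powr)
    finally show ?thesis .
  qed
  have "fd_convex k' I f"
    by (rule k_convex_on_imp_fd_convex[OF f(1)]) (use k' f(2) u(5) in linarith)
  then have main: "real (energy (8 ^ k') I f) / N ^ (2 * 8 ^ k') \<le> N powr (- real k' / 2)"
    by (intro energy_fd_convex_le[OF I K K1 _ _ cond]) auto
  have "u ^ 1 \<le> u ^ 4" using u(3) by (intro power_increasing) auto
  then have "real (8 ^ k') \<le> real l" using eight u(1) by simp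
  then have "8 ^ k' \<le> l" by (simp only: of_nat_le_iff)
  also have "l \<le> 2 ^ l" by (simp add: less_imp_le)
  finally have "8 ^ k' \<le> (2 ^ l :: nat)" .
  then have "real (energy (2 ^ l) I f) / N ^ (2 * 2 ^ l) \<le> real (energy (8 ^ k') I f) / N ^ (2 * 8 ^ k')"
    unfolding I(2) by (intro energy_antimono I) auto
  also note main
  also have "N powr (- real k' / 2) \<le> N powr (- \<theta> / 100)"
    using N1 k' u(5) by (intro powr_mono) linarith+
  finally show ?thesis .
qed

text \<open>For \<open>\<theta> \<le> 100\<close> saving one factor \<open>N\<close> is enough, and
  a one-point image is trivial. Otherwise the cases of few and many points are separated at
  \<open>log 2 N = sqrt l\<close>.\<close>

lemma energy_bound:
  fixes k l :: nat and I :: "real set" and f :: "real \<Rightarrow> real" and \<epsilon> :: real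
  assumes fin: "finite I" and conv: "k_convex_on k I f" and \<epsilon>: "\<epsilon> \<ge> 0"
    and E: "real (card (sum_diff_set I)) \<le> real (card I) powr (1 + \<epsilon>)"
    and l: "1 \<le> l" "l \<le> 2 ^ k" "\<epsilon> \<le> log 2 (real l) / real l"
  shows "real (energy (2 ^ l) (f ` I) (\<lambda>x. x)) \<le> real (card I) powr (2 ^ (l + 1) - log 2 (real l) / 100)"
\<comment> \<open>Here \<open>0 powr x = 0\<close>, but the energy vanishes too, because
  \<open>2 ^ l\<close> is positive.\<close>
proof (cases "I = {}")
  case True
  then show ?thesis using energy_le_card_power[of "f ` I" "2 ^ l" "\<lambda>x. x"] by (simp add: power_0_left)
next
  case False
  define N where "N = real (card I)"
  define A where "A = f ` I"
  define \<theta> where "\<theta> = log 2 (real l)"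
  define M :: nat where "M = 2 ^ l"
  have N: "N \<ge> 1" using False fin by (simp add: N_def Suc_le_eq card_gt_0_iff)
  have A: "finite A" "card A \<ge> 1" "real (card A) \<le> N"
    using False fin by (auto simp: A_def N_def Suc_le_eq card_gt_0_iff card_image_le)
  have \<theta>0: "\<theta> \<ge> 0" using l by (simp add: \<theta>_def)
  have M1: "M \<ge> 1" by (simp add: M_def)
  have reduce: "real (energy M A (\<lambda>x. x)) \<le> N powr (2 ^ (l + 1) - \<theta> / 100)"
    if "real (energy M A (\<lambda>x. x)) / N ^ (2 * M) \<le> N powr (- \<theta> / 100)"
  proof -
    have "real (energy M A (\<lambda>x. x)) \<le> N ^ (2 * M) * N powr (- \<theta> / 100)"
      using that N by (simp add: field_simps)
    also have "N ^ (2 * M) = N powr (2 ^ (l + 1))"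
      using N by (simp add: powr_realpow[symmetric] M_def)
    also have "N powr (2 ^ (l + 1)) * N powr (- \<theta> / 100) = N powr (2 ^ (l + 1) - \<theta> / 100)"
      by (simp add: powr_add[symmetric])
    finally show ?thesis .
  qed
  consider (small) "\<theta> \<le> 100" | (single) "card A = 1" | (large) "\<theta> > 100" "card A \<ge> 2"
    using A by linarith
  then have "real (energy M A (\<lambda>x. x)) \<le> N powr (2 ^ (l + 1) - \<theta> / 100)"
  proof cases
    case small
    have "real (energy M A (\<lambda>x. x)) / real (card A) ^ (2 * M) \<le> real (energy 1 A (\<lambda>x. x)) / real (card A) ^ (2 * 1)"
      by (rule energy_antimono) (use A M1 in auto)
    also have "\<dots> \<le> real (card A) / real (card A) ^ (2 * 1)"
      using energy_1_le[OF A(1)] by (intro divide_right_mono) auto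
    finally have "real (energy M A (\<lambda>x. x)) \<le> real (card A) ^ (2 * M) / real (card A)"
      using A(2) by (simp add: field_simps power2_eq_square)
    also have "\<dots> = real (card A) ^ (2 * M - 1)"
      using A(2) M1 by (subst power_diff) auto
    also have "\<dots> \<le> N ^ (2 * M - 1)" using A by (intro power_mono) auto
    also have "\<dots> = N powr (real (2 * M - 1))" using N by (simp add: powr_realpow)
    also have "\<dots> \<le> N powr (2 ^ (l + 1) - \<theta> / 100)"
    proof (intro powr_mono N)
      have "real (2 * M - 1) = 2 ^ (l + 1) - 1" using M1 by (simp add: of_nat_diff M_def)
      then show "real (2 * M - 1) \<le> 2 ^ (l + 1) - \<theta> / 100" using small by linarith
    qed
    finally show ?thesis .
  next
    case single
    have "real (energy M A (\<lambda>x. x)) \<le> 1"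
      using energy_le_card_power[OF A(1), of M] single by simp
    also have "1 \<le> N powr (2 ^ (l + 1) - \<theta> / 100)"
    proof (rule ge_one_powr_ge_zero[OF N])
      have "\<theta> \<le> real l" unfolding \<theta>_def using l log2_of_power_le[of l l] by (simp add: less_imp_le)
      also have "real l \<le> real (2 ^ l)" unfolding of_nat_le_iff by (simp add: less_imp_le)
      finally show "0 \<le> 2 ^ (l + 1) - \<theta> / 100" using \<theta>0 by simp
    qed
    finally show ?thesis .
  next
    case large
    define u where "u = 2 powr (\<theta> / 4)"
    have "u ^ 4 = 2 powr \<theta>" by (simp add: u_def powr_realpow[symmetric] powr_powr)
    then have lu: "real l = u ^ 4" using l by (simp add: \<theta>_def)
    have "2 powr 25 \<le> u" unfolding u_def using large by (intro powr_mono) auto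
    then have u25: "u \<ge> 1000" by simp
    have \<theta>u: "\<theta> \<le> 8 * u" using two_powr_ge[of "\<theta> / 4"] by (simp add: u_def)
    show ?thesis
    proof (rule reduce, cases "log 2 N \<le> u\<^sup>2")
      case True
      then show "real (energy M A (\<lambda>x. x)) / N ^ (2 * M) \<le> N powr (- \<theta> / 100)"
        unfolding M_def by (intro few_points_case[OF A(1) large(2) A(3) lu u25 \<theta>u \<theta>0])
    next
      case False
      \<comment> \<open>The hypothesis \<open>l \<le> 2 ^ k\<close> supplies enough orders of
        convexity for the choice of \<open>k'\<close>.\<close>
      have \<theta>k: "\<theta> \<le> real k"
        unfolding \<theta>_def using l by (intro log2_of_power_le) auto
      have "real (energy M A (\<lambda>x. x)) / N ^ (2 * M) \<le> real (energy M I f) / N ^ (2 * M)"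
        using energy_image_le[OF fin, of M f] N by (intro divide_right_mono) (auto simp: A_def)
      also have "\<dots> \<le> N powr (- \<theta> / 100)"
        unfolding M_def
      proof (rule many_points_case[OF fin N_def _ conv \<theta>k \<epsilon> _ _ lu u_def u25 \<theta>u])
        show "real (card (sum_diff_set I)) \<le> N powr (1 + \<epsilon>)" unfolding N_def by (rule E)
        show "\<epsilon> \<le> \<theta> / real l" unfolding \<theta>_def by (rule l(3))
      qed (use N large False in linarith)+
      finally show "real (energy M A (\<lambda>x. x)) / N ^ (2 * M) \<le> N powr (- \<theta> / 100)" .
    qed
  qed
  then show ?thesis by (simp add: M_def A_def N_def \<theta>_def)
qed

theorem theorem14:
  "\<exists>c C :: real. c > 0 \<and> C > 0 \<and>
     (\<forall>(k::nat) (I::real set) (f::real \<Rightarrow> real) (\<epsilon>::real).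
        k \<ge> 1 \<longrightarrow> finite I \<longrightarrow> k_convex_on k I f \<longrightarrow> \<epsilon> \<ge> 0 \<longrightarrow>
        real (card (sum_diff_set I)) \<le> real (card I) powr (1 + \<epsilon>) \<longrightarrow>
        (\<forall>l::nat. 1 \<le> l \<longrightarrow> l \<le> 2 ^ k \<longrightarrow> \<epsilon> \<le> log 2 (real l) / real l \<longrightarrow>
           real (additive_energy (2 ^ l) (f ` I))
             \<le> C * real (card I) powr (2 ^ (l + 1) - c * log 2 (real l))))"
proof (intro exI conjI allI impI)
  fix k l :: nat and I :: "real set" and f :: "real \<Rightarrow> real" and \<epsilon> :: real
  assume "finite I" "k_convex_on k I f" "\<epsilon> \<ge> 0"
    "real (card (sum_diff_set I)) \<le> real (card I) powr (1 + \<epsilon>)"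
    "1 \<le> l" "l \<le> 2 ^ k" "\<epsilon> \<le> log 2 (real l) / real l"
  from energy_bound[OF this]
  show "real (additive_energy (2 ^ l) (f ` I))
      \<le> 1 * real (card I) powr (2 ^ (l + 1) - 1/100 * log 2 (real l))"
    by (simp add: additive_energy_eq_energy)
qed simp_all

end
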